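(* Let $\sigma>0$, $\alpha\in(1,2]$, $X_t\sim L(0,\sigma^\alpha,-1)$ and $\mu=\frac{\sigma^\alpha}{\cos\frac{\pi\alpha}{2}}$. Let $\mathcal{P}(S_T,\underline{K})$ be a payoff function, and put $$G_\alpha^*(s_1):=\frac{1}{\alpha}\,\frac{\Gamma(1-s_1)}{\Gamma(1-\frac{s_1}{\alpha})},\qquad K^*(s_1):=\int_{-\infty}^{+\infty}\mathcal{P}\left(Se^{(r+\mu)\tau+x},\underline{K}\right)x^{s_1-1}\,dx .$$ Assume that the integral defining $K^*(s_1)$ converges for $\mathrm{Re}(s_1)\in(c_-,c_+)$ for some real numbers $c_-<c_+$, and that $(\tilde c_-,\tilde c_+):=(c_-,c_+)\cap(-\infty,-1)$ is nonempty. Let $c_1\in(\tilde c_-,\tilde c_+)$. Then the value at time $t$ of an option with maturity $T$ and payoff $\mathcal{P}(S_T,\underline{K})$ is equal to $$C_\alpha(S,\underline{K},r,\mu,\tau)=e^{-r\tau}\int_{c_1-i\infty}^{c_1+i\infty}K^*(s_1)\,G_\alpha^*(s_1)\,(-\mu\tau)^{-\frac{s_1}{\alpha}}\,\frac{ds_1}{2i\pi}.$$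
   Context: $L(0,\sigma^\alpha,-1)$ denotes the spectrally negative $\alpha$-stable Lévy process (Finite Moment Log Stable process) with characteristic function $\mathbb{E}[e^{ikX_t}]=\exp\left(-t\,\sigma^\alpha|k|^\alpha\left(1+i\tan\frac{\alpha\pi}{2}\,\mathrm{sgn}\,k\right)\right)$, $k\in\mathbb{R}$; its moment generating function is $\mathbb{E}[e^{pX_t}]=e^{-\mu t p^\alpha}$ for $p>0$. The payoff $\mathcal{P}:\mathbb{R}_+^{1+N}\to\mathbb{R}$ is a non time-dependent function of the terminal price $S_T$ and of positive parameters $\underline{K}=(K_1,\dots,K_N)$. Under the risk-neutral measure $\mathbb{Q}$ the asset price satisfies $S_T=S\,e^{(r+\mu)\tau+X_\tau}$, where $S$ is the price at time $t$, $r\in\mathbb{R}$ is the risk-free interest rate and $\tau=T-t$ is the time-to-maturity. The option value at time $t$ is the risk-neutral conditional expectation of the discounted payoff, $$C_\alpha(S,\underline{K},r,\mu,\tau)=\mathbb{E}_t^{\mathbb{Q}}\left[e^{-r\tau}\mathcal{P}(S_T,\underline{K})\right]=e^{-r\tau}\int_{-\infty}^{+\infty}\mathcal{P}\left(Se^{(r+\mu)\tau+x},\underline{K}\right)g_\alpha(x,\tau)\,dx,$$ with $g_\alpha(x,t)$ the density of $X_t$.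
   Formalization: The formal theorem additionally assumes that the payoff P(Se^{(r+μ)τ+x},K) vanishes for almost every x<0, where the complex power x^{s-1} is undefined; for the indicator of x in [-2,-1] with the principal branch the contour integral diverges. *)

theory Defs
  imports "HOL-Probability.Probability"
begin

text \<open>
  Real-valued Levy processes on the time axis \<open>{0..}\<close>, relative to a filtration \<open>F\<close>
  (increments are independent of the past and not only of each other).
\<close>

definition levy_process ::
  "'a measure \<Rightarrow> (real \<Rightarrow> 'a measure) \<Rightarrow> (real \<Rightarrow> 'a \<Rightarrow> real) \<Rightarrow> bool" where
  "levy_process Q F X \<longleftrightarrow>
     prob_space Q \<and>
     (\<forall>t\<ge>0. subalgebra Q (F t)) \<and>
     (\<forall>s t. 0 \<le> s \<and> s \<le> t \<longrightarrow> subalgebra (F t) (F s)) \<and>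
     (\<forall>t\<ge>0. X t \<in> borel_measurable (F t)) \<and>
     (AE \<omega> in Q. X 0 \<omega> = 0) \<and>
     (\<forall>s t. 0 \<le> s \<and> s \<le> t \<longrightarrow>
        prob_space.indep_set Q (sets (F s))
          (sets (vimage_algebra (space Q) (\<lambda>\<omega>. X t \<omega> - X s \<omega>) borel))) \<and>
     (\<forall>s t. 0 \<le> s \<and> s \<le> t \<longrightarrow>
        distr Q borel (\<lambda>\<omega>. X t \<omega> - X s \<omega>) = distr Q borel (X (t - s))) \<and>
     (\<forall>s\<ge>0. \<forall>\<epsilon>>0.
        ((\<lambda>t. measure Q {\<omega> \<in> space Q. \<bar>X t \<omega> - X s \<omega>\<bar> > \<epsilon>}) \<longlongrightarrow> 0) (at s within {0..}))"

text \<open>The process \<open>L(0, \<sigma>\<^sup>\<alpha>, -1)\<close>.\<close>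

definition fmls_process ::
  "real \<Rightarrow> real \<Rightarrow> 'a measure \<Rightarrow> (real \<Rightarrow> 'a measure) \<Rightarrow> (real \<Rightarrow> 'a \<Rightarrow> real) \<Rightarrow> bool" where
  "fmls_process \<sigma> \<alpha> Q F X \<longleftrightarrow>
     levy_process Q F X \<and>
     (\<forall>t\<ge>0. \<forall>k. char (distr Q borel (X t)) k =
        exp (- complex_of_real (t * \<sigma> powr \<alpha> * \<bar>k\<bar> powr \<alpha>)
             * (1 + \<i> * complex_of_real (tan (\<alpha> * pi / 2) * sgn k))))"

text \<open>
  The terminal price given that the price at time \<open>t\<close> is \<open>S\<close>. The random term of the exponent
  is the increment of \<open>X\<close> over \<open>[t, T]\<close>: it has the law of \<open>X (T - t)\<close> and is
  independent of \<open>F t\<close>, whereas \<open>X (T - t)\<close> itself is in general not independent of \<open>F t\<close>.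
\<close>

definition terminal_price ::
  "real \<Rightarrow> real \<Rightarrow> real \<Rightarrow> (real \<Rightarrow> 'a \<Rightarrow> real) \<Rightarrow> real \<Rightarrow> real \<Rightarrow> 'a \<Rightarrow> real" where
  "terminal_price S r \<mu> X t T \<omega> = S * exp ((r + \<mu>) * (T - t) + (X T \<omega> - X t \<omega>))"

definition discounted_payoff ::
  "(real \<Rightarrow> real ^ 'n \<Rightarrow> real) \<Rightarrow> real \<Rightarrow> real ^ 'n \<Rightarrow> real \<Rightarrow> real \<Rightarrow> (real \<Rightarrow> 'a \<Rightarrow> real)
     \<Rightarrow> real \<Rightarrow> real \<Rightarrow> 'a \<Rightarrow> real" where
  "discounted_payoff P S K r \<mu> X t T \<omega> =
     exp (- r * (T - t)) * P (terminal_price S r \<mu> X t T \<omega>) K"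

definition option_value ::
  "'a measure \<Rightarrow> (real \<Rightarrow> 'a measure) \<Rightarrow> (real \<Rightarrow> real ^ 'n \<Rightarrow> real) \<Rightarrow> real \<Rightarrow> real ^ 'n
     \<Rightarrow> real \<Rightarrow> real \<Rightarrow> (real \<Rightarrow> 'a \<Rightarrow> real) \<Rightarrow> real \<Rightarrow> real \<Rightarrow> 'a \<Rightarrow> real" where
  "option_value Q F P S K r \<mu> X t T =
     real_cond_exp Q (F t) (discounted_payoff P S K r \<mu> X t T)"

definition G_star :: "real \<Rightarrow> complex \<Rightarrow> complex" where
  "G_star \<alpha> s = 1 / complex_of_real \<alpha> * (Gamma (1 - s) / Gamma (1 - s / complex_of_real \<alpha>))"

text \<open>
  For \<open>x < 0\<close> the complex power takes its principal value; this convention matters only for payoffs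
  that do not vanish there.
\<close>

definition K_star_integrand ::
  "(real \<Rightarrow> real ^ 'n \<Rightarrow> real) \<Rightarrow> real \<Rightarrow> real ^ 'n \<Rightarrow> real \<Rightarrow> real \<Rightarrow> real \<Rightarrow> complex \<Rightarrow> real \<Rightarrow> complex" where
  "K_star_integrand P S K r \<mu> \<tau> s x =
     complex_of_real (P (S * exp ((r + \<mu>) * \<tau> + x)) K) * complex_of_real x powr (s - 1)"

definition K_star ::
  "(real \<Rightarrow> real ^ 'n \<Rightarrow> real) \<Rightarrow> real \<Rightarrow> real ^ 'n \<Rightarrow> real \<Rightarrow> real \<Rightarrow> real \<Rightarrow> complex \<Rightarrow> complex" where
  "K_star P S K r \<mu> \<tau> s = (LINT x|lborel. K_star_integrand P S K r \<mu> \<tau> s x)"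

text \<open>
  The integral of \<open>f\<close> along the line from \<open>c - \<i>\<infinity>\<close> to \<open>c + \<i>\<infinity>\<close>, parametrised by
  \<open>s = c + \<i> u\<close>, so that \<open>ds = \<i> du\<close>.
\<close>

definition vertical_integrable :: "(complex \<Rightarrow> complex) \<Rightarrow> real \<Rightarrow> bool" where
  "vertical_integrable f c \<longleftrightarrow> integrable lborel (\<lambda>u. f (Complex c u) * \<i>)"

definition vertical_integral :: "(complex \<Rightarrow> complex) \<Rightarrow> real \<Rightarrow> complex" where
  "vertical_integral f c = (LINT u|lborel. f (Complex c u) * \<i>)"

end

theory Submission
  imports Defs "HOL-Complex_Analysis.Cauchy_Integral_Theorem" "HOL-Real_Asymp.Real_Asymp"
begin

text \<open>
  Put \<open>m = - \<mu> \<tau> > 0\<close>. The characteristic function of the increment over \<open>[t, T]\<close> is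
  \<open>exp (m (\<i> k)\<^sup>\<alpha>)\<close>, which is integrable, so the increment has a density \<open>g\<close> given by Fourier
  inversion. For \<open>x > 0\<close> the contour can be moved from the imaginary axis to \<open>Re \<zeta> = 1\<close>, so that
  \<open>2 \<pi> \<i> g x\<close> is the integral of \<open>exp (m \<zeta>\<^sup>\<alpha> - \<zeta> x)\<close> along that line. The Mellin transform of this
  expression is \<open>\<Gamma> (1 + z)\<close> times the line integral \<open>J z\<close> of \<open>\<zeta> powr (- 1 - z) * exp (m \<zeta>\<^sup>\<alpha>)\<close>.
  For \<open>Re z < 0\<close> the contour of \<open>J\<close> can be pushed back to the imaginary axis, where Euler's integral and
  the reflection formula evaluate it; integration by parts gives \<open>z J z = m \<alpha> J (z - \<alpha>)\<close>, which
  carries the value to all \<open>z\<close> that are needed. So the Mellin transform of \<open>g\<close> is essentially \<open>G\<^sup>*\<close>,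
  which decays exponentially on vertical lines. Mellin inversion then writes \<open>g\<close> as a vertical
  integral of \<open>G\<^sup>*\<close>, and Fubini's theorem turns the integral of payoff times \<open>g\<close> into the formula.
\<close>

section \<open>Fourier inversion\<close>

text \<open>Two obstructions fix the choice of contours. On the imaginary axis
  \<open>exp (- \<zeta> x)\<close> has modulus 1, so exchanging the Mellin integral in x with the
  integral in \<zeta> is not absolutely justified; on \<open>Re \<zeta> = 1\<close> the factor
  \<open>exp (- x)\<close> makes the double integral converge absolutely. The axis, however, is
  where the integral can be computed, and there \<open>\<zeta> powr (- 1 - z)\<close> is integrable
  at 0 only for \<open>Re z < 0\<close>, whereas the line \<open>Re s = c\<close> of the formula
  corresponds to z = - s with \<open>Re z = - c > 1\<close>. The recurrence for \<open>J\<close>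
  bridges this gap. The condition \<alpha> > 1 enters twice: \<open>(\<i> v) powr \<alpha>\<close>
  has negative real part of order \<open>\<bar>v\<bar> powr \<alpha>\<close>, which dominates the
  linear error made by moving into the strip; and the decay of the numerator of
  \<open>G_star\<close> exceeds the growth of its reciprocal denominator. The Mellin transform sees
  the density only on the positive half-line, which is enough for payoffs that vanish for almost
  every x < 0. For negative x the principal power \<open>x powr (s - 1)\<close> would also grow
  exponentially along one end of the vertical line.\<close>

lemma gaussian_fourier:
  fixes e w :: real
  assumes e: "e > 0"
  shows "has_bochner_integral lborel (\<lambda>u. iexp (u * w) * complex_of_real (exp (- ((e * u)\<^sup>2) / 2)))
     (complex_of_real (2 * pi * normal_density 0 e w))"
proof -
  define h where "h = (\<lambda>v. iexp ((w / e) * v) * complex_of_real (std_normal_density v))"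
  have int: "integrable lborel h"
  proof (rule Bochner_Integration.integrable_bound)
    show "integrable lborel std_normal_density" by simp
    show "AE x in lborel. norm (h x) \<le> norm (std_normal_density x)"
      by (simp add: h_def norm_mult del: of_real_mult)
  qed (auto simp: h_def)
  have "char std_normal_distribution (w/e) = (CLINT v|lborel. h v)"
    unfolding char_def h_def
    by (subst integral_density) (auto simp: scaleR_conv_of_real mult.commute)
  then have val: "(CLINT v|lborel. h v) = complex_of_real (exp (- ((w/e)^2) / 2))"
    by (simp add: char_std_normal_distribution)
  have hb: "has_bochner_integral lborel h (complex_of_real (exp (- ((w/e)^2) / 2)))"
    using int val by (simp add: has_bochner_integral_iff)
  then have "has_bochner_integral lborel (\<lambda>u. h (0 + e * u))
      (complex_of_real (exp (- ((w/e)^2) / 2)) /\<^sub>R \<bar>e\<bar>)"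
    using lborel_has_bochner_integral_real_affine_iff[of e h "complex_of_real (exp (- ((w/e)^2) / 2))" 0] e by simp
  then have "has_bochner_integral lborel (\<lambda>u. complex_of_real (sqrt (2 * pi)) * h (0 + e * u))
      (complex_of_real (sqrt (2 * pi)) * (complex_of_real (exp (- ((w/e)^2) / 2)) /\<^sub>R \<bar>e\<bar>))"
    by (rule has_bochner_integral_mult_right)
  moreover have "(\<lambda>u. complex_of_real (sqrt (2 * pi)) * h (0 + e * u)) =
      (\<lambda>u. iexp (u * w) * complex_of_real (exp (- ((e * u)\<^sup>2) / 2)))"
  proof
    fix u
    have "(w / e) * (0 + e * u) = u * w" using e by simp
    moreover have "sqrt (2 * pi) * std_normal_density (0 + e * u) = exp (- ((e * u)\<^sup>2) / 2)"
      by (simp add: std_normal_density_def)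
    ultimately show "complex_of_real (sqrt (2 * pi)) * h (0 + e * u) =
        iexp (u * w) * complex_of_real (exp (- ((e * u)\<^sup>2) / 2))"
      unfolding h_def by (metis (no_types, lifting) mult.left_commute of_real_mult)
  qed
  moreover have "complex_of_real (sqrt (2 * pi)) * (complex_of_real (exp (- ((w/e)^2) / 2)) /\<^sub>R \<bar>e\<bar>)
      = complex_of_real (2 * pi * normal_density 0 e w)"
  proof -
    have "sqrt (2 * pi * e\<^sup>2) = sqrt (2 * pi) * e"
      using e by (simp add: real_sqrt_mult)
    then have "sqrt (2 * pi) * sqrt (2 * pi * e\<^sup>2) = 2 * pi * e"
      by (simp only: mult.assoc[symmetric]) simp
    then have "sqrt (2 * pi) / e = 2 * pi / sqrt (2 * pi * e\<^sup>2)"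
      using e by (simp add: field_simps)
    then have "sqrt (2 * pi) * (exp (- ((w/e)^2) / 2) / e) = 2 * pi * normal_density 0 e w"
      using e unfolding normal_density_def by (simp add: power_divide field_simps)
    moreover have "complex_of_real (sqrt (2 * pi)) * (complex_of_real (exp (- ((w/e)^2) / 2)) /\<^sub>R \<bar>e\<bar>)
        = complex_of_real (sqrt (2 * pi) * (exp (- ((w/e)^2) / 2) / e))"
      using e by (simp add: scaleR_conv_of_real field_simps)
    ultimately show ?thesis by (simp only:)
  qed
  ultimately show ?thesis by simp
qed
lemma iexp_mult: "iexp a * iexp b = iexp (a + b)"
  by (simp add: exp_add distrib_left)

lemma integrable_product_lborel:
  fixes f g :: "real \<Rightarrow> complex"
  assumes f: "integrable lborel f" and g: "integrable lborel g"
  shows "integrable (lborel \<Otimes>\<^sub>M lborel) (\<lambda>(x, y). f x * g y)"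
proof (rule lborel_pair.Fubini_integrable)
  have [measurable]: "f \<in> borel_measurable borel" "g \<in> borel_measurable borel"
    using f g by auto
  show "(\<lambda>(x, y). f x * g y) \<in> borel_measurable (lborel \<Otimes>\<^sub>M lborel)"
    by measurable
qed (use f g in \<open>simp_all add: norm_mult\<close>)

text \<open>A factor \<open>exp (- (e u)^2 / 2)\<close> makes the double integral absolutely
  convergent, and exchanging the order produces the average of \<open>f\<close> against a normal
  density of width \<open>e\<close> centred at \<open>x\<close>. As \<open>e\<close> tends to 0,
  both sides converge by domination: the left by integrability of \<open>F\<close>, the right by the
  bound \<open>B\<close>, with continuity at \<open>x\<close> identifying the limit.\<close>

lemma fourier_inversion:
  fixes f :: "real \<Rightarrow> complex" and x B :: real
  assumes f: "integrable lborel f" and B: "\<And>y. norm (f y) \<le> B" and cont: "isCont f x"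
  defines "F \<equiv> (\<lambda>u. CLINT y|lborel. f y * iexp (- (u * y)))"
  assumes F: "integrable lborel F"
  shows "(CLINT u|lborel. F u * iexp (u * x)) = 2 * pi * f x"
proof -
  have fm[measurable]: "f \<in> borel_measurable borel" using f by auto
  have Fm[measurable]: "F \<in> borel_measurable borel" using F by auto
  define L where "L = (\<lambda>e::real. CLINT u|lborel. F u * iexp (u * x) * complex_of_real (exp (- ((e * u)\<^sup>2) / 2)))"
  have L_eq: "L e = 2 * pi * (CLINT w|lborel. f (x - e * w) * complex_of_real (std_normal_density w))" if e: "e > 0" for e
  proof -
    define G where "G = (\<lambda>u. complex_of_real (exp (- ((e * u)\<^sup>2) / 2)))"
    have Gi: "integrable lborel G"
      using gaussian_fourier[OF e, of 0] by (simp add: has_bochner_integral_iff G_def)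
    have int2: "integrable (lborel \<Otimes>\<^sub>M lborel) (\<lambda>(u, y). G u * f y)"
      by (rule integrable_product_lborel[OF Gi f])
    have int3: "integrable (lborel \<Otimes>\<^sub>M lborel) (\<lambda>(u, y). f y * iexp (- (u * y)) * (iexp (u * x) * G u))"
      by (rule Bochner_Integration.integrable_bound[OF int2]) (auto simp: norm_mult G_def)
    have "L e = (CLINT u|lborel. CLINT y|lborel. f y * iexp (- (u * y)) * (iexp (u * x) * G u))"
      unfolding L_def F_def G_def
      by (intro Bochner_Integration.integral_cong refl, subst integral_mult_left_zero) (rule mult.assoc)
    also have "\<dots> = (CLINT y|lborel. CLINT u|lborel. f y * iexp (- (u * y)) * (iexp (u * x) * G u))"
      by (rule lborel_pair.Fubini_integral[symmetric]) (use int3 in simp)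
    also have "\<dots> = (CLINT y|lborel. f y * (2 * pi * normal_density 0 e (x - y)))"
    proof (intro Bochner_Integration.integral_cong refl)
      fix y
      have "f y * iexp (- (u * y)) * (iexp (u * x) * G u) = f y * (iexp (u * (x - y)) * G u)" for u
        using iexp_mult[of "- (u * y)" "u * x"] by (simp add: algebra_simps)
      then have "(CLINT u|lborel. f y * iexp (- (u * y)) * (iexp (u * x) * G u)) = (CLINT u|lborel. f y * (iexp (u * (x - y)) * G u))"
        by (simp only:)
      also have "\<dots> = f y * (2 * pi * normal_density 0 e (x - y))"
        using gaussian_fourier[OF e, of "x - y"] by (simp add: has_bochner_integral_iff G_def)
      finally show "(CLINT u|lborel. f y * iexp (- (u * y)) * (iexp (u * x) * G u)) = f y * (2 * pi * normal_density 0 e (x - y))" .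
    qed
    \<comment> \<open>The substitution \<open>y = x - e * w\<close> moves \<open>e\<close> out of
      the kernel and into the argument of \<open>f\<close>, so that one fixed Gaussian can
      dominate.\<close>
    also have "\<dots> = \<bar>- e\<bar> *\<^sub>R (CLINT w|lborel. f (x + (- e) * w) * (2 * pi * normal_density 0 e (x - (x + (- e) * w))))"
      by (rule lborel_integral_real_affine) (use e in auto)
    also have "\<dots> = (CLINT w|lborel. \<bar>- e\<bar> *\<^sub>R (f (x + (- e) * w) * (2 * pi * normal_density 0 e (x - (x + (- e) * w)))))"
      by (rule integral_scaleR_right[symmetric])
    also have "\<dots> = (CLINT w|lborel. 2 * pi * (f (x - e * w) * complex_of_real (std_normal_density w)))"
    proof (intro Bochner_Integration.integral_cong refl)
      fix w
      have "e * normal_density 0 e (e * w) = std_normal_density w"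
        using e by (simp add: normal_density_def real_sqrt_mult power_mult_distrib)
      then have "complex_of_real e * complex_of_real (normal_density 0 e (e * w)) = complex_of_real (std_normal_density w)"
        by (metis of_real_mult)
      then show "\<bar>- e\<bar> *\<^sub>R (f (x + (- e) * w) * (2 * pi * normal_density 0 e (x - (x + (- e) * w)))) = 2 * pi * (f (x - e * w) * complex_of_real (std_normal_density w))"
        using e by (simp add: scaleR_conv_of_real ac_simps)
    qed
    also have "\<dots> = 2 * pi * (CLINT w|lborel. f (x - e * w) * complex_of_real (std_normal_density w))"
      by (rule integral_mult_right_zero)
    finally show ?thesis .
  qed
  define e where "e = (\<lambda>n. inverse (real (Suc n)))"
  have epos: "e n > 0" for n by (simp add: e_def)
  have elim: "e \<longlonglongrightarrow> 0" unfolding e_def by (rule LIMSEQ_inverse_real_of_nat)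
  have "(\<lambda>n. L (e n)) \<longlonglongrightarrow> (CLINT u|lborel. F u * iexp (u * x))"
    unfolding L_def
  proof (rule integral_dominated_convergence)
    show "integrable lborel (\<lambda>u. norm (F u))" using F by auto
    show "AE u in lborel. (\<lambda>n. F u * iexp (u * x) * complex_of_real (exp (- ((e n * u)\<^sup>2) / 2))) \<longlonglongrightarrow> F u * iexp (u * x)"
    proof (intro AE_I2)
      fix u
      have "(\<lambda>n. F u * iexp (u * x) * complex_of_real (exp (- ((e n * u)\<^sup>2) / 2))) \<longlonglongrightarrow> F u * iexp (u * x) * complex_of_real (exp (- ((0 * u)\<^sup>2) / 2))"
        by (intro tendsto_intros elim) auto
      then show "(\<lambda>n. F u * iexp (u * x) * complex_of_real (exp (- ((e n * u)\<^sup>2) / 2))) \<longlonglongrightarrow> F u * iexp (u * x)" by simp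
    qed
  qed (auto simp: norm_mult intro!: mult_left_le)
  moreover have "(\<lambda>n. L (e n)) \<longlonglongrightarrow> 2 * pi * (CLINT w|lborel. f x * complex_of_real (std_normal_density w))"
    unfolding L_eq[OF epos]
  proof (intro tendsto_mult tendsto_const integral_dominated_convergence)
    show "integrable lborel (\<lambda>w. B * std_normal_density w)" by simp
    show "AE w in lborel. (\<lambda>n. f (x - e n * w) * complex_of_real (std_normal_density w)) \<longlonglongrightarrow> f x * complex_of_real (std_normal_density w)"
    proof (intro AE_I2 tendsto_mult tendsto_const)
      fix w
      have "(\<lambda>n. x - e n * w) \<longlonglongrightarrow> x - 0 * w" by (intro tendsto_intros elim)
      then show "(\<lambda>n. f (x - e n * w)) \<longlonglongrightarrow> f x"
        using isCont_tendsto_compose[OF cont] by simp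
    qed
    show "AE w in lborel. norm (f (x - e n * w) * complex_of_real (std_normal_density w)) \<le> B * std_normal_density w" for n
      using B by (auto simp: norm_mult intro!: mult_right_mono)
  qed auto
  moreover have "(CLINT w|lborel. f x * complex_of_real (std_normal_density w)) = f x"
    by simp
  ultimately show ?thesis
    using LIMSEQ_unique by metis
qed

text \<open>The functions \<open>s n\<close> are the densities of \<open>M\<close> convolved with
  centred normal laws of width \<open>e n\<close>. They are nonnegative and converge to
  \<open>G / (2 * pi)\<close>, which is therefore real and nonnegative although it is defined by an
  oscillating integral. Inversion applied to \<open>char M\<close> shows that the limit has the
  right characteristic function, and uniqueness concludes.\<close>

lemma density_from_char:
  fixes M :: "real measure"
  assumes "real_distribution M" and ch: "integrable lborel (char M)"
  defines "G \<equiv> (\<lambda>x. CLINT k|lborel. char M k * iexp (- (k * x)))"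
  shows "\<exists>g. (\<forall>x. g x \<ge> 0 \<and> G x = complex_of_real (2 * pi * g x)) \<and> g \<in> borel_measurable borel
     \<and> M = density lborel g"
proof -
  interpret real_distribution M by fact
  define e where "e = (\<lambda>n. inverse (real (Suc n)))"
  have epos: "e n > 0" for n by (simp add: e_def)
  have elim: "e \<longlonglongrightarrow> 0" unfolding e_def by (rule LIMSEQ_inverse_real_of_nat)
  define s where "s = (\<lambda>n x. LINT y|M. normal_density 0 (e n) (y - x))"
  interpret P: pair_sigma_finite lborel M ..
  have smeas[measurable]: "s n \<in> borel_measurable borel" for n
    unfolding s_def by measurable
  have spos: "s n x \<ge> 0" for n x unfolding s_def by simp
  have bnd: "normal_density 0 (e n) z \<le> 1 / sqrt (2 * pi * (e n)\<^sup>2)" for n z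
    unfolding normal_density_def by (simp add: divide_right_mono)
  have nint: "integrable M (\<lambda>y. normal_density 0 (e n) (y - x))" for n x
    by (rule integrable_const_bound[where B="1 / sqrt (2 * pi * (e n)\<^sup>2)"]) (auto simp: bnd)
  have s_eq: "(CLINT k|lborel. char M k * iexp (- (k * x)) * complex_of_real (exp (- ((e n * k)\<^sup>2) / 2))) = complex_of_real (2 * pi * s n x)" for n x
  proof -
    define G where "G = (\<lambda>u. complex_of_real (exp (- ((e n * u)\<^sup>2) / 2)))"
    have Gi: "integrable lborel G"
      using gaussian_fourier[OF epos[of n], of 0] by (simp add: has_bochner_integral_iff G_def)
    have int2: "integrable (lborel \<Otimes>\<^sub>M M) (\<lambda>(u, y). G u)"
    proof (rule P.Fubini_integrable)
      show "integrable lborel (\<lambda>u. LINT y|M. norm (case (u, y) of (u, y) \<Rightarrow> G u))"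
        using Gi prob_space by simp
      show "AE u in lborel. integrable M (\<lambda>y. case (u, y) of (u, y) \<Rightarrow> G u)"
        by simp
      show "(\<lambda>(u, y). G u) \<in> borel_measurable (lborel \<Otimes>\<^sub>M M)"
        unfolding G_def by measurable
    qed
    have int3: "integrable (lborel \<Otimes>\<^sub>M M) (\<lambda>(u, y). iexp (u * y) * (iexp (- (u * x)) * G u))"
      by (rule Bochner_Integration.integrable_bound[OF int2]) (auto simp: norm_mult G_def)
    have "(CLINT k|lborel. char M k * iexp (- (k * x)) * complex_of_real (exp (- ((e n * k)\<^sup>2) / 2))) =
      (CLINT u|lborel. CLINT y|M. iexp (u * y) * (iexp (- (u * x)) * G u))"
      unfolding char_def G_def
      by (intro Bochner_Integration.integral_cong refl, subst integral_mult_left_zero) (rule mult.assoc)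
    also have "\<dots> = (CLINT y|M. CLINT u|lborel. iexp (u * y) * (iexp (- (u * x)) * G u))"
      by (rule P.Fubini_integral[symmetric]) (use int3 in simp)
    also have "\<dots> = (CLINT y|M. (2 * pi * normal_density 0 (e n) (y - x)))"
    proof (intro Bochner_Integration.integral_cong refl)
      fix y
      have "iexp (u * y) * (iexp (- (u * x)) * G u) = (iexp (u * (y - x)) * G u)" for u
        using iexp_mult[of "u * y" "- (u * x)"] by (simp add: algebra_simps)
      then have "(CLINT u|lborel. iexp (u * y) * (iexp (- (u * x)) * G u)) = (CLINT u|lborel. iexp (u * (y - x)) * G u)"
        by (simp only:)
      also have "\<dots> = (2 * pi * normal_density 0 (e n) (y - x))"
        using gaussian_fourier[OF epos[of n], of "y - x"] by (simp add: has_bochner_integral_iff G_def)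
      finally show "(CLINT u|lborel. iexp (u * y) * (iexp (- (u * x)) * G u)) = (2 * pi * normal_density 0 (e n) (y - x))" .
    qed
    also have "\<dots> = complex_of_real (2 * pi * s n x)"
      unfolding s_def by simp
    finally show ?thesis .
  qed
  have lim: "(\<lambda>n. complex_of_real (2 * pi * s n x)) \<longlonglongrightarrow> G x" for x
    unfolding s_eq[symmetric] G_def
  proof (rule integral_dominated_convergence)
    show "integrable lborel (\<lambda>u. norm (char M u))" using ch by auto
    show "AE u in lborel. (\<lambda>n. char M u * iexp (- (u * x)) * complex_of_real (exp (- ((e n * u)\<^sup>2) / 2))) \<longlonglongrightarrow> char M u * iexp (- (u * x))"
    proof (intro AE_I2)
      fix u
      have "(\<lambda>n. char M u * iexp (- (u * x)) * complex_of_real (exp (- ((e n * u)\<^sup>2) / 2))) \<longlonglongrightarrow> char M u * iexp (- (u * x)) * complex_of_real (exp (- ((0 * u)\<^sup>2) / 2))"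
        by (intro tendsto_intros elim) auto
      then show "(\<lambda>n. char M u * iexp (- (u * x)) * complex_of_real (exp (- ((e n * u)\<^sup>2) / 2))) \<longlonglongrightarrow> char M u * iexp (- (u * x))" by simp
    qed
  qed (use ch in \<open>auto simp: norm_mult intro!: mult_left_le\<close>)
  define g where "g = (\<lambda>x. Re (G x) / (2 * pi))"
  have limg: "(\<lambda>n. s n x) \<longlonglongrightarrow> g x" for x
  proof -
    have "(\<lambda>n. Re (complex_of_real (2 * pi * s n x)) / (2 * pi)) \<longlonglongrightarrow> g x"
      unfolding g_def by (intro tendsto_intros lim) auto
    then show ?thesis by simp
  qed
  have gpos: "g x \<ge> 0" for x
    using LIMSEQ_le_const[OF limg[of x], of 0] spos by blast
  have gm[measurable]: "g \<in> borel_measurable borel"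
    using limg by (rule borel_measurable_LIMSEQ_metric[rotated]) simp
  have Gg: "G x = complex_of_real (2 * pi * g x)" for x
  proof -
    have "(\<lambda>n. complex_of_real (2 * pi * s n x)) \<longlonglongrightarrow> complex_of_real (2 * pi * g x)"
      by (intro tendsto_intros limg)
    then show ?thesis using lim LIMSEQ_unique by blast
  qed
  have s1: "(\<integral>\<^sup>+x. ennreal (s n x) \<partial>lborel) = 1" for n
  proof -
    have "(\<integral>\<^sup>+x. ennreal (s n x) \<partial>lborel) = (\<integral>\<^sup>+x. (\<integral>\<^sup>+y. ennreal (normal_density 0 (e n) (y - x)) \<partial>M) \<partial>lborel)"
      unfolding s_def by (intro nn_integral_cong nn_integral_eq_integral[symmetric] nint) auto
    also have "\<dots> = (\<integral>\<^sup>+y. (\<integral>\<^sup>+x. ennreal (normal_density 0 (e n) (y - x)) \<partial>lborel) \<partial>M)"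
      by (rule P.Fubini'[symmetric]) measurable
    also have "\<dots> = (\<integral>\<^sup>+y. (\<integral>\<^sup>+x. ennreal (normal_density y (e n) x) \<partial>lborel) \<partial>M)"
      by (intro nn_integral_cong) (simp add: normal_density_def power2_commute)
    also have "\<dots> = (\<integral>\<^sup>+y. 1 \<partial>M)"
      using epos by (intro nn_integral_cong, subst nn_integral_eq_integral) (auto simp: integral_normal_density)
    finally show ?thesis using emeasure_space_1 by simp
  qed
  \<comment> \<open>Fatou's lemma bounds the mass only by 1, which is what integrability needs; that
    no mass escapes is read off below from the inversion formula at frequency 0.\<close>
  have "(\<integral>\<^sup>+x. ennreal (g x) \<partial>lborel) = (\<integral>\<^sup>+x. liminf (\<lambda>n. ennreal (s n x)) \<partial>lborel)"
    by (intro nn_integral_cong lim_imp_Liminf[symmetric]) (auto intro!: limg)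
  also have "\<dots> \<le> liminf (\<lambda>n. \<integral>\<^sup>+x. ennreal (s n x) \<partial>lborel)"
    by (rule nn_integral_liminf) measurable
  also have "\<dots> = 1" by (simp add: s1 Liminf_const)
  finally have gfin: "(\<integral>\<^sup>+x. ennreal (g x) \<partial>lborel) \<le> 1" .
  have gint: "integrable lborel g"
    using gfin gpos by (intro integrableI_nonneg) (auto intro: le_less_trans)
  have inv: "(CLINT x|lborel. complex_of_real (g x) * iexp (k * x)) = char M k" for k
  proof -
    \<comment> \<open>The roles are reversed here: the function being inverted is
      \<open>char M\<close>, which is continuous and bounded by 1, and its Fourier transform is
      \<open>G\<close>.\<close>
    have "(CLINT u|lborel. (CLINT y|lborel. char M y * iexp (- (u * y))) * iexp (u * k)) = 2 * pi * char M k"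
    proof (rule fourier_inversion[where B=1])
      have "(\<lambda>u. CLINT y|lborel. char M y * iexp (- (u * y))) = G"
        unfolding G_def by (simp add: mult.commute)
      moreover have "integrable lborel G" unfolding Gg[abs_def] using gint by auto
      ultimately show "complex_integrable lborel (\<lambda>u. CLINT y|lborel. char M y * iexp (- (u * y)))" by simp
    qed (use ch isCont_char cmod_char_le_1 in auto)
    also have "(CLINT u|lborel. (CLINT y|lborel. char M y * iexp (- (u * y))) * iexp (u * k))
      = (CLINT u|lborel. G u * iexp (u * k))"
      unfolding G_def by (simp add: mult.commute)
    also have "\<dots> = (CLINT u|lborel. (2 * pi) * (complex_of_real (g u) * iexp (k * u)))"
      unfolding Gg by (simp add: mult_ac)
    finally show ?thesis by simp
  qed
  have "density lborel g = M"
  proof (rule Levy_uniqueness)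
    have "complex_of_real (LINT x|lborel. g x) = 1"
      using inv[of 0] by (simp add: char_zero)
    then have "(LINT x|lborel. g x) = 1" by (metis of_real_eq_1_iff)
    then have "(\<integral>\<^sup>+x. ennreal (g x) \<partial>lborel) = 1"
      using nn_integral_eq_integral[OF gint] gpos by simp
    then have "prob_space (density lborel g)"
      by (intro prob_spaceI) (simp add: emeasure_density)
    then show "real_distribution (density lborel g)"
      by (simp add: real_distribution_def real_distribution_axioms_def)
    show "char (density lborel (\<lambda>x. ennreal (g x))) = char M"
    proof
      fix k
      have "char (density lborel (\<lambda>x. ennreal (g x))) k = (CLINT x|lborel. complex_of_real (g x) * iexp (k * x))"
        unfolding char_def using gpos by (subst integral_density) (auto simp: scaleR_conv_of_real)
      then show "char (density lborel (\<lambda>x. ennreal (g x))) k = char M k" using inv by simp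
    qed
  qed fact
  then show ?thesis using gpos Gg gm by blast
qed

section \<open>Euler's integral and vertical decay of the Gamma function\<close>

text \<open>Passes from gauge integrals, in which Euler's integral is available, to Lebesgue
  integrals over \<open>lborel\<close>. Borel measurability is a separate premise because absolute
  integrability gives it only for the completed measure.\<close>

lemma has_bochner_integral_restrict_absolutely:
  fixes f :: "real \<Rightarrow> complex"
  assumes meas: "(\<lambda>t. indicator S t *\<^sub>R f t) \<in> borel_measurable borel"
    and abs: "f absolutely_integrable_on S" and int: "(f has_integral v) S"
  shows "has_bochner_integral lborel (\<lambda>t. indicator S t *\<^sub>R f t) v"
proof -
  have i: "integrable lborel (\<lambda>t. indicator S t *\<^sub>R f t)"
    using abs meas unfolding set_integrable_def by (subst (asm) integrable_completion) auto
  have "((\<lambda>t. indicator S t *\<^sub>R f t) has_integral v) UNIV"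
    using int by (simp add: indicator_scaleR_eq_if has_integral_restrict_UNIV)
  then show ?thesis
    using has_integral_integral_lborel[OF i] i has_integral_unique
    by (auto simp: has_bochner_integral_iff)
qed

text \<open>The change of variable t = exp x turns Mellin integrals into Fourier integrals and power
  substitutions into linear ones. Being an equivalence, it carries integrability together with the
  value in both directions.\<close>

lemma has_bochner_integral_exp_substitution:
  fixes f :: "real \<Rightarrow> complex"
  assumes meas[measurable]: "f \<in> borel_measurable borel"
  shows "has_bochner_integral lborel (\<lambda>t. indicator {0<..} t *\<^sub>R f t) v
     \<longleftrightarrow> has_bochner_integral lborel (\<lambda>x. exp x *\<^sub>R f (exp x)) v" (is "?L \<longleftrightarrow> ?R")
proof -
  have "range (exp :: real \<Rightarrow> real) = {0<..}"
    by (auto simp: image_iff) (metis exp_ln)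
  then have eq: "((\<lambda>x. \<bar>exp x\<bar> *\<^sub>R f (exp x)) absolutely_integrable_on UNIV \<and> integral UNIV (\<lambda>x. \<bar>exp x\<bar> *\<^sub>R f (exp x)) = v)
     \<longleftrightarrow> (f absolutely_integrable_on {0<..} \<and> integral {0<..} f = v)"
    using has_absolute_integral_change_of_variables_real[of UNIV exp exp f v]
    by (auto simp: inj_on_def)
  have conv: "has_bochner_integral lborel (\<lambda>t. indicator S t *\<^sub>R h t) v \<longleftrightarrow>
      (h absolutely_integrable_on S \<and> integral S h = v)"
    if [measurable]: "(\<lambda>t. indicator S t *\<^sub>R h t) \<in> borel_measurable borel" for S and h :: "real \<Rightarrow> complex"
  proof
    assume b: "has_bochner_integral lborel (\<lambda>t. indicator S t *\<^sub>R h t) v"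
    then have "integrable lborel (\<lambda>t. indicator S t *\<^sub>R h t)"
      by (simp add: has_bochner_integral_iff)
    then show "h absolutely_integrable_on S \<and> integral S h = v"
      using b set_borel_integral_eq_integral(2)[of S h]
      by (auto simp: set_integrable_def set_lebesgue_integral_def has_bochner_integral_iff integrable_completion)
  next
    assume "h absolutely_integrable_on S \<and> integral S h = v"
    then show "has_bochner_integral lborel (\<lambda>t. indicator S t *\<^sub>R h t) v"
      by (intro has_bochner_integral_restrict_absolutely)
        (auto simp: set_lebesgue_integral_eq_integral(1) integrable_integral)
  qed
  have "?L \<longleftrightarrow> (f absolutely_integrable_on {0<..} \<and> integral {0<..} f = v)"
    by (rule conv) measurable
  also have "\<dots> \<longleftrightarrow> has_bochner_integral lborel (\<lambda>x. indicator UNIV x *\<^sub>R (\<bar>exp x\<bar> *\<^sub>R f (exp x))) v"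
    unfolding eq[symmetric] by (rule conv[symmetric]) measurable
  finally show ?thesis by simp
qed

text \<open>Powers of positive reals are written \<open>exp (z * ln t)\<close>: unlike \<open>powr\<close> on the complex numbers
  this is recognised as a measurable function of \<open>t\<close>.\<close>

lemma Gamma_integral_exp:
  assumes s: "Re s > 0"
  shows "has_bochner_integral lborel
    (\<lambda>t. indicator {0<..} t *\<^sub>R (exp ((s - 1) * complex_of_real (ln t)) * exp (- complex_of_real t))) (Gamma s)"
proof (rule has_bochner_integral_restrict_absolutely)
  have eq: "complex_of_real t powr (s - 1) / complex_of_real (exp t) = exp ((s - 1) * complex_of_real (ln t)) * exp (- complex_of_real t)"
    if "t \<in> {0<..}" for t
    using that by (simp add: powr_def exp_minus divide_inverse exp_of_real Ln_of_real)
  show "(\<lambda>t. exp ((s - 1) * complex_of_real (ln t)) * exp (- complex_of_real t)) absolutely_integrable_on {0<..}"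
    using absolutely_integrable_Gamma_integral'[OF s] eq
    by (metis (no_types, lifting) set_integrable_cong)
  show "((\<lambda>t. exp ((s - 1) * complex_of_real (ln t)) * exp (- complex_of_real t)) has_integral Gamma s) {0<..}"
    using has_integral_eq[OF eq Gamma_integral_complex'[OF s]] .
qed measurable

lemma Gamma_integral_exp_real:
  assumes x: "(x::real) > 0"
  shows "has_bochner_integral lborel
    (\<lambda>t. indicator {0<..} t * (exp ((x - 1) * ln t) * exp (- t))) (Gamma x)"
proof -
  have "has_bochner_integral lborel
    (\<lambda>t. Re (indicator {0<..} t *\<^sub>R (exp ((complex_of_real x - 1) * complex_of_real (ln t)) * exp (- complex_of_real t))))
    (Re (Gamma (complex_of_real x)))"
    by (intro has_bochner_integral_bounded_linear[OF bounded_linear_Re] Gamma_integral_exp) (use x in simp)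
  moreover have "exp ((complex_of_real x - 1) * complex_of_real (ln t)) * exp (- complex_of_real t)
      = complex_of_real (exp ((x - 1) * ln t) * exp (- t))" for t
    by (simp flip: exp_of_real)
  ultimately show ?thesis by (simp add: Gamma_complex_of_real)
qed

text \<open>The signs cancel, leaving the coefficients of the binomial series of
  \<open>(1 - x) powr (- a)\<close>. The same identity serves the real series of absolute values and
  the complex series itself.\<close>

lemma gbinomial_uminus_mult_power:
  fixes a x :: "'a :: field_char_0"
  shows "(- a gchoose n) * (- x) ^ n = pochhammer a n / fact n * x ^ n"
proof -
  have "(- a gchoose n) * (- x) ^ n = pochhammer a n / fact n * ((- 1) ^ n * (- x) ^ n)"
    by (simp add: gbinomial_pochhammer)
  also have "(- 1) ^ n * (- x) ^ n = x ^ n"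
    by (simp flip: power_mult_distrib)
  finally show ?thesis .
qed

text \<open>With w = 1 - l, the factor \<open>exp (- l t)\<close> is \<open>exp (- t)\<close> times
  the exponential series of \<open>w t\<close>. Integrating term by term gives
  \<open>\<Gamma> (s + n) w^n / n!\<close>, that is, \<open>\<Gamma> s\<close> times the binomial
  series of \<open>(1 - w) powr (- s)\<close>. The exchange is justified by the real binomial series
  with \<open>Re s\<close> and \<open>norm w\<close> in place of s and w.\<close>

lemma Gamma_integral_disc:
  assumes s: "Re s > 0" and l: "norm (1 - l) < 1"
  shows "has_bochner_integral lborel
    (\<lambda>t. indicator {0<..} t *\<^sub>R (exp ((s - 1) * complex_of_real (ln t)) * exp (- (l * complex_of_real t)))) (Gamma s * l powr (- s))"
proof -
  define w where "w = 1 - l"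
  have wn: "norm w < 1" using l by (simp add: w_def)
  define a where "a = Re s"
  have a: "a > 0" using s by (simp add: a_def)
  have snp: "s \<notin> \<int>\<^sub>\<le>\<^sub>0" using s by (auto elim!: nonpos_Ints_cases)
  have anp: "a \<notin> \<int>\<^sub>\<le>\<^sub>0" using a by (auto elim!: nonpos_Ints_cases)
  define f where "f = (\<lambda>n t. indicator {0<..} t *\<^sub>R (exp ((s - 1) * complex_of_real (ln t)) * exp (- complex_of_real t) * ((w * complex_of_real t) ^ n /\<^sub>R fact n)))"
  have f_eq: "f n t = (w ^ n /\<^sub>R fact n) * (indicator {0<..} t *\<^sub>R (exp ((s + of_nat n - 1) * complex_of_real (ln t)) * exp (- complex_of_real t)))" for n t
  proof (cases "t > 0")
    case True
    have "exp ((s + of_nat n - 1) * complex_of_real (ln t)) = exp ((s - 1) * complex_of_real (ln t)) * exp (complex_of_real (ln t)) ^ n"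
      by (simp add: exp_of_nat_mult[symmetric] mult_exp_exp algebra_simps)
    also have "exp (complex_of_real (ln t)) = complex_of_real t"
      using True by (simp add: exp_of_real)
    finally show ?thesis
      by (simp add: f_def power_mult_distrib)
  qed (simp add: f_def)
  have f_int: "has_bochner_integral lborel (f n) ((w ^ n /\<^sub>R fact n) * Gamma (s + of_nat n))" for n
    unfolding f_eq[abs_def]
    by (rule has_bochner_integral_mult_right) (rule Gamma_integral_exp, use s in simp)
  have nf_int: "has_bochner_integral lborel (\<lambda>t. norm (f n t)) ((norm w ^ n / fact n) * Gamma (a + of_nat n))" for n
  proof -
    have eq: "(\<lambda>t. norm (f n t)) = (\<lambda>t. (norm w ^ n / fact n) * (indicator {0<..} t * (exp ((a + of_nat n - 1) * ln t) * exp (- t))))"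
      unfolding f_eq by (simp add: norm_mult norm_power a_def divide_inverse ac_simps)
    show ?thesis
      unfolding eq by (rule has_bochner_integral_mult_right, rule Gamma_integral_exp_real) (use a in linarith)
  qed
  have poch: "(\<lambda>n. (- a gchoose n) * (- norm w) ^ n) = (\<lambda>n. pochhammer (a::real) n / fact n * norm w ^ n)"
    by (rule ext) (rule gbinomial_uminus_mult_power)
  have summ: "summable (\<lambda>n. (norm w ^ n / fact n) * Gamma (a + of_nat n))"
  proof -
    have "summable (\<lambda>n. (- a gchoose n) * (- norm w) ^ n)"
      using gen_binomial_real[of "- norm w" "- a"] l unfolding w_def by (intro sums_summable) simp
    then have "summable (\<lambda>n. Gamma a * (pochhammer a n / fact n * norm w ^ n))"
      unfolding poch by (rule summable_mult)
    also have "(\<lambda>n. Gamma a * (pochhammer a n / fact n * norm w ^ n)) = (\<lambda>n. (norm w ^ n / fact n) * Gamma (a + of_nat n))"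
      using anp by (simp add: pochhammer_Gamma Gamma_eq_zero_iff mult.commute)
    finally show ?thesis .
  qed
  have sm: "(\<lambda>n. (w ^ n /\<^sub>R fact n) * Gamma (s + of_nat n)) sums (Gamma s * l powr (- s))"
  proof -
    have "(\<lambda>n. (- s gchoose n) * (- w) ^ n) sums (1 + (- w)) powr (- s)"
      by (rule gen_binomial_complex) (use wn in simp)
    moreover have "1 + (- w) = l" by (simp add: w_def)
    ultimately have "(\<lambda>n. Gamma s * ((- s gchoose n) * (- w) ^ n)) sums (Gamma s * l powr (- s))"
      by (metis sums_mult)
    also have "(\<lambda>n. Gamma s * ((- s gchoose n) * (- w) ^ n)) = (\<lambda>n. (w ^ n /\<^sub>R fact n) * Gamma (s + of_nat n))"
    proof
      fix n
      have "(- s gchoose n) * (- w) ^ n = pochhammer s n / fact n * w ^ n"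
        by (rule gbinomial_uminus_mult_power)
      then show "Gamma s * ((- s gchoose n) * (- w) ^ n) = (w ^ n /\<^sub>R fact n) * Gamma (s + of_nat n)"
        using snp by (simp add: pochhammer_Gamma Gamma_eq_zero_iff scaleR_conv_of_real divide_inverse)
    qed
    finally show ?thesis .
  qed
  have fsums: "(\<lambda>n. f n t) sums (indicator {0<..} t *\<^sub>R (exp ((s - 1) * complex_of_real (ln t)) * exp (- (l * complex_of_real t))))" for t
  proof -
    have "(\<lambda>n. f n t) sums (indicator {0<..} t *\<^sub>R (exp ((s - 1) * complex_of_real (ln t)) * exp (- complex_of_real t) * exp (w * complex_of_real t)))"
      unfolding f_def by (intro sums_scaleR_right sums_mult exp_converges)
    moreover have "exp (- complex_of_real t) * exp (w * complex_of_real t) = exp (- (l * complex_of_real t))"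
      unfolding w_def by (simp add: mult_exp_exp algebra_simps)
    ultimately show ?thesis by (simp add: mult.assoc)
  qed
  have fn: "summable (\<lambda>n. norm (f n t))" for t
  proof -
    have "summable (\<lambda>n. norm ((w * complex_of_real t) ^ n /\<^sub>R fact n))"
      by (rule summable_norm_exp)
    then have "summable (\<lambda>n. norm (indicator {0<..} t *\<^sub>R (exp ((s - 1) * complex_of_real (ln t)) * exp (- complex_of_real t))) * norm ((w * complex_of_real t) ^ n /\<^sub>R fact n))"
      by (rule summable_mult)
    moreover have "norm (f n t) = norm (indicator {0<..} t *\<^sub>R (exp ((s - 1) * complex_of_real (ln t)) * exp (- complex_of_real t))) * norm ((w * complex_of_real t) ^ n /\<^sub>R fact n)" for n
      unfolding f_def by (simp only: norm_mult norm_scaleR mult.assoc)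
    ultimately show ?thesis by (simp only:)
  qed
  have i: "integrable lborel (f n)" for n by (rule integrable.intros[OF f_int])
  have fAE: "AE t in lborel. summable (\<lambda>n. norm (f n t))" using fn by (rule AE_I2)
  have fS: "summable (\<lambda>n. LINT t|lborel. norm (f n t))"
    unfolding has_bochner_integral_integral_eq[OF nf_int] by (rule summ)
  have "integrable lborel (\<lambda>t. \<Sum>n. f n t)" "(LINT t|lborel. (\<Sum>n. f n t)) = (\<Sum>n. LINT t|lborel. f n t)"
    using integrable_suminf[OF i fAE fS] integral_suminf[OF i fAE fS] .
  moreover have "(\<Sum>n. LINT t|lborel. f n t) = Gamma s * l powr (- s)"
    unfolding has_bochner_integral_integral_eq[OF f_int] using sm by (rule sums_unique[symmetric])
  moreover have "(\<lambda>t. \<Sum>n. f n t) = (\<lambda>t. indicator {0<..} t *\<^sub>R (exp ((s - 1) * complex_of_real (ln t)) * exp (- (l * complex_of_real t))))"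
    using fsums by (intro ext) (rule sums_unique[symmetric])
  ultimately show ?thesis by (simp add: has_bochner_integral_iff)
qed

text \<open>Rescaling t by a positive r replaces l by l / r, and every l in the open right
  half-plane can be brought into the unit disc around 1 in this way.\<close>

lemma Gamma_integral_halfplane:
  assumes s: "Re s > 0" and l: "Re l > 0"
  shows "has_bochner_integral lborel
    (\<lambda>t. indicator {0<..} t *\<^sub>R (exp ((s - 1) * complex_of_real (ln t)) * exp (- (l * complex_of_real t)))) (Gamma s * l powr (- s))"
proof -
  \<comment> \<open>With this r, \<open>norm (r - l) ^ 2 = r ^ 2 - norm l ^ 2 < r ^ 2\<close>, so
    \<open>l / r\<close> has distance less than 1 from 1.\<close>
  define r where "r = norm l ^ 2 / Re l"
  have nl: "norm l > 0" "l \<noteq> 0" using l by auto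
  have r: "r > 0" using l nl by (simp add: r_def)
  have "norm (r - l) ^ 2 < r ^ 2"
  proof -
    have "norm (r - l) ^ 2 = r ^ 2 - 2 * r * Re l + norm l ^ 2"
      unfolding cmod_power2 by (simp add: power2_eq_square algebra_simps)
    also have "2 * r * Re l = 2 * norm l ^ 2" using l by (simp add: r_def)
    finally show ?thesis using nl by simp
  qed
  then have "norm (r - l) < r" using r by (metis less_eq_real_def power2_less_imp_less)
  moreover have "1 - l / r = (r - l) / r" using r by (simp add: diff_divide_distrib)
  ultimately have d: "norm (1 - l / r) < 1" using r by (simp add: norm_divide)
  define h where "h = (\<lambda>t. indicator {0<..} t *\<^sub>R (exp ((s - 1) * complex_of_real (ln t)) * exp (- (l / r * complex_of_real t))))"
  have "has_bochner_integral lborel h (Gamma s * (l / r) powr (- s))"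
    unfolding h_def by (rule Gamma_integral_disc[OF s d])
  then have "has_bochner_integral lborel (\<lambda>t. h (0 + r * t)) ((Gamma s * (l / r) powr (- s)) /\<^sub>R \<bar>r\<bar>)"
    using lborel_has_bochner_integral_real_affine_iff[of r h _ 0] r by simp
  then have "has_bochner_integral lborel (\<lambda>t. exp ((1 - s) * complex_of_real (ln r)) * h (0 + r * t))
      (exp ((1 - s) * complex_of_real (ln r)) * ((Gamma s * (l / r) powr (- s)) /\<^sub>R \<bar>r\<bar>))"
    by (rule has_bochner_integral_mult_right)
  moreover have "exp ((1 - s) * complex_of_real (ln r)) * h (0 + r * t) =
     indicator {0<..} t *\<^sub>R (exp ((s - 1) * complex_of_real (ln t)) * exp (- (l * complex_of_real t)))" for t
  proof (cases "t > 0")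
    case True
    have "exp ((1 - s) * complex_of_real (ln r)) * exp ((s - 1) * complex_of_real (ln (r * t))) = exp ((s - 1) * complex_of_real (ln t))"
      using True r by (simp add: mult_exp_exp ln_mult algebra_simps)
    then show ?thesis using True r by (simp add: h_def)
  next
    case False
    then show ?thesis using r by (simp add: h_def zero_less_mult_iff)
  qed
  moreover have "exp ((1 - s) * complex_of_real (ln r)) * ((Gamma s * (l / r) powr (- s)) /\<^sub>R \<bar>r\<bar>) = Gamma s * l powr (- s)"
  proof -
    have "(l / r) powr (- s) = exp (- s * Ln l) * exp (s * complex_of_real (ln r))"
      using r nl by (simp add: powr_def Ln_divide_of_real mult_exp_exp algebra_simps)
    moreover have "exp ((1 - s) * complex_of_real (ln r)) = r * inverse (exp (s * complex_of_real (ln r)))"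
      using r by (simp add: algebra_simps exp_diff exp_of_real divide_inverse)
    ultimately show ?thesis using r nl by (simp add: powr_def scaleR_conv_of_real field_simps)
  qed
  ultimately show ?thesis by simp
qed

section \<open>Integrable majorants and bounds for Gamma functions on vertical lines\<close>

lemma integrable_abs_powr_exp:
  fixes a d :: real
  assumes a: "a > -1" and d: "d > 0"
  shows "integrable lborel (\<lambda>v. \<bar>v\<bar> powr a * exp (- d * \<bar>v\<bar>))"
proof -
  define h where "h = (\<lambda>v::real. indicator {0<..} v * (v powr a * exp (- d * v)))"
  have "integrable lborel (\<lambda>t. Re (indicator {0<..} t *\<^sub>R (exp ((complex_of_real (a + 1) - 1) * complex_of_real (ln t)) * exp (- (complex_of_real d * complex_of_real t)))))"
    using Gamma_integral_halfplane[of "complex_of_real (a + 1)" "complex_of_real d"] a d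
    by (intro integrable_Re) (simp add: has_bochner_integral_iff)
  also have "(\<lambda>t. Re (indicator {0<..} t *\<^sub>R (exp ((complex_of_real (a + 1) - 1) * complex_of_real (ln t)) * exp (- (complex_of_real d * complex_of_real t))))) = h"
  proof
    fix t :: real
    have "exp ((complex_of_real (a + 1) - 1) * complex_of_real (ln t)) * exp (- (complex_of_real d * complex_of_real t)) = complex_of_real (exp (a * ln t) * exp (- d * t))"
      by (simp flip: exp_of_real)
    then show "Re (indicator {0<..} t *\<^sub>R (exp ((complex_of_real (a + 1) - 1) * complex_of_real (ln t)) * exp (- (complex_of_real d * complex_of_real t)))) = h t"
      by (simp add: h_def powr_def split: split_indicator)
  qed
  finally have h: "integrable lborel h" .
  have "integrable lborel (\<lambda>v. h (0 + (-1) * v))"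
    by (rule lborel_integrable_real_affine[OF h]) simp
  then have "integrable lborel (\<lambda>v. h v + h (- v))" using h by simp
  moreover have "h v + h (- v) = \<bar>v\<bar> powr a * exp (- d * \<bar>v\<bar>)" for v
    by (auto simp: h_def split: split_indicator)
  ultimately show ?thesis by simp
qed

lemma integrable_exp_abs:
  fixes d :: real
  assumes d: "d > 0"
  shows "integrable lborel (\<lambda>v. exp (- d * \<bar>v\<bar>))"
proof -
  \<comment> \<open>The value of \<open>0 powr 0\<close> is 0, so the two integrands differ at the
    origin.\<close>
  have "AE v in lborel. v \<noteq> (0::real)" by (rule AE_lborel_singleton)
  then have "AE v in lborel. \<bar>v\<bar> powr 0 * exp (- d * \<bar>v\<bar>) = exp (- d * \<bar>v\<bar>)"
    by eventually_elim simp
  then show ?thesis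
    using integrable_abs_powr_exp[of 0 d] d by (subst integrable_cong_AE[symmetric]) auto
qed

text \<open>Rotating Euler's integral by an angle \<phi> multiplies the Gamma value by
  \<open>cis \<phi> powr (- s)\<close>, whose modulus is \<open>exp (u * \<phi>)\<close>, while the
  modulus of the rotated integrand does not depend on u. Giving \<phi> the sign of u yields decay at
  every rate \<theta> below pi / 2, without Stirling's formula.\<close>

lemma Gamma_vertical_bound:
  assumes a: "a > 0" and th: "0 \<le> \<theta>" "\<theta> < pi / 2"
  shows "\<exists>C. \<forall>u. norm (Gamma (Complex a u)) \<le> C * exp (- \<theta> * \<bar>u\<bar>)"
proof (intro exI allI)
  fix u :: real
  define \<phi> where "\<phi> = (if u \<ge> 0 then \<theta> else - \<theta>)"
  define s where "s = Complex a u"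
  have cphi: "cos \<phi> = cos \<theta>" "u * \<phi> = \<bar>u\<bar> * \<theta>" by (auto simp: \<phi>_def)
  have cpos: "cos \<theta> > 0" using th by (intro cos_gt_zero_pi) auto
  have *: "has_bochner_integral lborel
    (\<lambda>t. indicator {0<..} t *\<^sub>R (exp ((s - 1) * complex_of_real (ln t)) * exp (- (cis \<phi> * complex_of_real t)))) (Gamma s * (cis \<phi>) powr (- s))"
    by (rule Gamma_integral_halfplane) (use a cpos cphi in \<open>auto simp: s_def\<close>)
  have Ln: "Ln (cis \<phi>) = \<i> * \<phi>"
    unfolding cis_conv_exp by (rule Ln_exp) (use th in \<open>auto simp: \<phi>_def\<close>)
  have "(cis \<phi>) powr (- s) = exp (- s * (\<i> * \<phi>))" using Ln by (simp add: powr_def)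
  then have "norm ((cis \<phi>) powr (- s)) = exp (\<bar>u\<bar> * \<theta>)"
    by (simp add: s_def cphi)
  then have "norm (Gamma s) * exp (\<bar>u\<bar> * \<theta>) = norm (Gamma s * (cis \<phi>) powr (- s))"
    by (simp add: norm_mult)
  also have "\<dots> \<le> (LINT t|lborel. norm (indicator {0<..} t *\<^sub>R (exp ((s - 1) * complex_of_real (ln t)) * exp (- (cis \<phi> * complex_of_real t)))))"
    unfolding has_bochner_integral_integral_eq[OF *, symmetric] by (rule integral_norm_bound)
  also have "\<dots> = (LINT t|lborel. indicator {0<..} t * (exp ((a - 1) * ln t) * exp (- (cos \<theta> * t))))"
    by (simp add: norm_mult s_def cphi)
  finally show "norm (Gamma (Complex a u)) \<le> (LINT t|lborel. indicator {0<..} t * (exp ((a - 1) * ln t) * exp (- (cos \<theta> * t)))) * exp (- \<theta> * \<bar>u\<bar>)"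
    by (simp add: s_def exp_minus field_simps)
qed

lemma norm_sin_le_exp: "norm (sin (z :: complex)) \<le> exp \<bar>Im z\<bar>"
proof -
  have "norm (sin z) = norm (exp (\<i> * z) - exp (- (\<i> * z))) / 2"
    by (simp add: sin_exp_eq norm_divide norm_mult)
  also have "\<dots> \<le> (norm (exp (\<i> * z)) + norm (exp (- (\<i> * z)))) / 2"
    by (intro divide_right_mono norm_triangle_ineq4) auto
  also have "\<dots> = (exp (- Im z) + exp (Im z)) / 2" by simp
  also have "\<dots> \<le> (exp \<bar>Im z\<bar> + exp \<bar>Im z\<bar>) / 2"
    by (intro divide_right_mono add_mono) auto
  finally show ?thesis by simp
qed

lemma continuous_on_rGamma_Complex: "continuous_on A (\<lambda>u. rGamma (Complex b (u * k)))"
  by (rule continuous_on_compose2[OF continuous_on_rGamma[of UNIV]]) (auto simp: Complex_eq intro!: continuous_intros)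

text \<open>Reflection writes \<open>rGamma w\<close> as
  \<open>\<Gamma> (1 - w) * sin (pi * w) / pi\<close>, where the Gamma factor decays like
  \<open>exp (- \<theta> * \<bar>u\<bar>)\<close> and the sine grows at most like
  \<open>exp (pi * \<bar>u\<bar>)\<close>. The decay estimate requires
  \<open>Re (1 - w) > 0\<close>, hence the preliminary shift to the left; small u are handled by
  compactness.\<close>

lemma rGamma_vertical_bound:
  assumes th: "0 \<le> \<theta>" "\<theta> < pi / 2"
  shows "\<exists>C. \<forall>u. norm (rGamma (Complex b u)) \<le> C * exp ((pi - \<theta>) * \<bar>u\<bar>)"
proof -
  obtain n :: nat where n: "b < real n" using reals_Archimedean2 by blast
  obtain C where C: "norm (Gamma (Complex (1 - b + real n) u)) \<le> C * exp (- \<theta> * \<bar>u\<bar>)" for u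
    using Gamma_vertical_bound[of "1 - b + real n" \<theta>] th n by auto
  \<comment> \<open>Each shift to the left multiplies \<open>rGamma\<close> by a number of modulus
    at least \<open>\<bar>u\<bar>\<close>, hence at least 1, so the modulus can only
    increase.\<close>
  have down: "norm (rGamma (Complex b u)) \<le> norm (rGamma (Complex (b - real k) u))" if u: "\<bar>u\<bar> \<ge> 1" for k u
  proof (induction k)
    case (Suc k)
    define z where "z = Complex (b - real (Suc k)) u"
    have "1 \<le> norm z" using u abs_Im_le_cmod[of z] by (simp add: z_def)
    then have "norm (rGamma (z + 1)) \<le> norm z * norm (rGamma (z + 1))"
      by (simp add: mult_le_cancel_right1)
    also have "\<dots> = norm (rGamma z)" by (metis norm_mult rGamma_plus1)
    finally have "norm (rGamma (Complex (b - real k) u)) \<le> norm (rGamma z)"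
      by (simp add: z_def complex_eq_iff one_complex.code plus_complex.code)
    then show ?case using Suc by (simp add: z_def)
  qed simp
  have far: "norm (rGamma (Complex b u)) \<le> (C / pi) * exp ((pi - \<theta>) * \<bar>u\<bar>)" if u: "\<bar>u\<bar> \<ge> 1" for u
  proof -
    define w where "w = Complex (b - real n) u"
    have w1: "1 - w = Complex (1 - b + real n) (- u)" by (simp add: w_def complex_eq_iff)
    have nz: "1 - w \<notin> \<int>\<^sub>\<le>\<^sub>0" using n by (auto simp: w1 elim!: nonpos_Ints_cases simp: complex_eq_iff)
    have "rGamma w * rGamma (1 - w) = sin (of_real pi * w) / of_real pi"
      by (rule rGamma_reflection_complex)
    then have "rGamma w = Gamma (1 - w) * sin (of_real pi * w) / of_real pi"
      using nz by (simp add: rGamma_inverse_Gamma[of "1 - w"] field_simps Gamma_eq_zero_iff)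
    then have "norm (rGamma w) = norm (Gamma (1 - w)) * norm (sin (of_real pi * w)) / pi"
      by (simp add: norm_mult norm_divide)
    also have "\<dots> \<le> (C * exp (- \<theta> * \<bar>- u\<bar>)) * exp (pi * \<bar>u\<bar>) / pi"
      using C[of "- u"] norm_sin_le_exp[of "of_real pi * w"] unfolding w1
      by (intro divide_right_mono mult_mono) (auto simp: w_def abs_mult intro: order_trans[OF norm_ge_zero])
    also have "\<dots> = (C / pi) * exp ((pi - \<theta>) * \<bar>u\<bar>)"
      by (simp add: mult_exp_exp algebra_simps)
    finally show ?thesis using down[OF u, of n] by (simp add: w_def)
  qed
  have "bounded ((\<lambda>u. rGamma (Complex b (u * 1))) ` {-1..1})"
    by (intro compact_imp_bounded compact_continuous_image continuous_on_rGamma_Complex compact_Icc)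
  then obtain D where "\<forall>u\<in>{-1..1}. norm (rGamma (Complex b u)) \<le> D"
    unfolding bounded_iff by auto
  then have D: "norm (rGamma (Complex b u)) \<le> D" if "\<bar>u\<bar> \<le> 1" for u
    using that by (auto simp: abs_le_iff)
  show ?thesis
  proof (intro exI allI)
    fix u
    have e1: "1 \<le> exp ((pi - \<theta>) * \<bar>u\<bar>)" using th by simp
    show "norm (rGamma (Complex b u)) \<le> (max (C / pi) D) * exp ((pi - \<theta>) * \<bar>u\<bar>)"
    proof (cases "\<bar>u\<bar> \<ge> 1")
      case True
      then show ?thesis using far[OF True] by (meson exp_ge_zero max.cobounded1 mult_right_mono order_trans)
    next
      case False
      then have "norm (rGamma (Complex b u)) \<le> D" by (intro D) simp
      moreover then have "0 \<le> D" by (rule order_trans[OF norm_ge_zero])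
      ultimately have "norm (rGamma (Complex b u)) \<le> D * exp ((pi - \<theta>) * \<bar>u\<bar>)"
        using e1 by (metis mult_left_mono mult.right_neutral order_trans)
      then show ?thesis by (meson exp_ge_zero max.cobounded2 mult_right_mono order_trans)
    qed
  qed
qed

text \<open>\<open>rGamma\<close> is entire, so continuity and bounds of this factor need no
  discussion of poles. At a pole of the denominator the defaults agree: \<open>Gamma\<close> is 0
  there, and division by it gives 0.\<close>

lemma G_star_eq_rGamma:
  "G_star \<alpha> s = Gamma (1 - s) * rGamma (1 - s / complex_of_real \<alpha>) / complex_of_real \<alpha>"
  by (simp add: G_star_def rGamma_inverse_Gamma divide_inverse)

lemma continuous_G_star_vertical:
  assumes "c < 1"
  shows "continuous_on UNIV (\<lambda>u. G_star \<alpha> (Complex c u))"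
proof -
  have "1 - Complex c u / complex_of_real \<alpha> = Complex (1 - c / \<alpha>) (u * (- 1 / \<alpha>))" for u
    by (simp add: complex_eq_iff)
  moreover have "continuous_on UNIV (\<lambda>u. Gamma (1 - Complex c u))"
  proof (rule continuous_on_compose2[OF continuous_on_Gamma[of "{z. Re z > 0}"]])
    show "{z. Re z > 0} \<inter> \<int>\<^sub>\<le>\<^sub>0 = {}"
      by (auto elim!: nonpos_Ints_cases)
    show "continuous_on UNIV (\<lambda>u. 1 - Complex c u)"
      unfolding Complex_eq by (intro continuous_intros)
  qed (use assms in auto)
  ultimately show ?thesis
    unfolding G_star_eq_rGamma divide_inverse[of _ "complex_of_real \<alpha>"]
    using continuous_on_rGamma_Complex[of UNIV "1 - c / \<alpha>" "- 1 / \<alpha>"]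
    by (intro continuous_on_mult continuous_on_const) (simp_all add: divide_inverse)
qed

lemma G_star_vertical_integrable:
  assumes al: "1 < \<alpha>" and c: "c < 1"
  shows "integrable lborel (\<lambda>u. G_star \<alpha> (Complex c u))"
proof -
  text \<open>The decay \<open>exp (- \<theta> \<bar>u\<bar>)\<close> of the numerator beats the growth
    \<open>exp ((\<pi> - \<theta>) \<bar>u\<bar> / \<alpha>)\<close> of the denominator as soon as \<open>\<theta> > \<pi> / (\<alpha> + 1)\<close>.\<close>
  define \<theta> where "\<theta> = (pi / (\<alpha> + 1) + pi / 2) / 2"
  \<comment> \<open>This strict inequality is where \<alpha> > 1 enters; \<theta> is the midpoint of
    the gap.\<close>
  have "pi / (\<alpha> + 1) < pi / 2" using al by (intro divide_strict_left_mono) auto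
  then have th: "0 \<le> \<theta>" "\<theta> < pi / 2" "pi / (\<alpha> + 1) < \<theta>" using al by (auto simp: \<theta>_def)
  define \<delta> where "\<delta> = \<theta> - (pi - \<theta>) / \<alpha>"
  have d: "\<delta> > 0" using th(3) al by (simp add: \<delta>_def field_simps)
  obtain C where C: "norm (Gamma (Complex (1 - c) u)) \<le> C * exp (- \<theta> * \<bar>u\<bar>)" for u
    using Gamma_vertical_bound[of "1 - c" \<theta>] th c by auto
  obtain D where D: "norm (rGamma (Complex (1 - c / \<alpha>) u)) \<le> D * exp ((pi - \<theta>) * \<bar>u\<bar>)" for u
    using rGamma_vertical_bound[of \<theta> "1 - c / \<alpha>"] th by auto
  show ?thesis
  proof (rule Bochner_Integration.integrable_bound)
    show "integrable lborel (\<lambda>u. C * D / \<alpha> * exp (- \<delta> * \<bar>u\<bar>))"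
      using integrable_exp_abs[OF d] by simp
    show "(\<lambda>u. G_star \<alpha> (Complex c u)) \<in> borel_measurable lborel"
      using borel_measurable_continuous_onI[OF continuous_G_star_vertical[OF c]] by simp
    show "AE u in lborel. norm (G_star \<alpha> (Complex c u)) \<le> norm (C * D / \<alpha> * exp (- \<delta> * \<bar>u\<bar>))"
    proof (rule AE_I2)
      fix u
      have e: "1 - Complex c u = Complex (1 - c) (- u)" "1 - Complex c u / complex_of_real \<alpha> = Complex (1 - c / \<alpha>) (- u / \<alpha>)"
        by (simp_all add: complex_eq_iff)
      have "norm (G_star \<alpha> (Complex c u)) = norm (Gamma (Complex (1 - c) (- u))) * norm (rGamma (Complex (1 - c / \<alpha>) (- u / \<alpha>))) / \<alpha>"
        using al unfolding G_star_eq_rGamma e by (simp add: norm_mult norm_divide)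
      also have "\<dots> \<le> (C * exp (- \<theta> * \<bar>- u\<bar>)) * (D * exp ((pi - \<theta>) * \<bar>- u / \<alpha>\<bar>)) / \<alpha>"
        using C[of "- u"] D[of "- u / \<alpha>"] al
        by (intro divide_right_mono mult_mono) (auto intro: order_trans[OF norm_ge_zero])
      also have "\<dots> = C * D / \<alpha> * (exp (- \<theta> * \<bar>u\<bar>) * exp ((pi - \<theta>) * (\<bar>u\<bar> / \<alpha>)))"
        using al by simp
      also have "exp (- \<theta> * \<bar>u\<bar>) * exp ((pi - \<theta>) * (\<bar>u\<bar> / \<alpha>)) = exp (- \<delta> * \<bar>u\<bar>)"
        by (simp add: mult_exp_exp \<delta>_def algebra_simps)
      finally show "norm (G_star \<alpha> (Complex c u)) \<le> norm (C * D / \<alpha> * exp (- \<delta> * \<bar>u\<bar>))"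
        by (metis abs_ge_self order_trans real_norm_def)
    qed
  qed
qed

section \<open>Contour integrals of the stable exponential\<close>

lemma closed_segment_horizontal:
  assumes "a \<le> b"
  shows "closed_segment (Complex a v) (Complex b v) \<subseteq> {z. a \<le> Re z \<and> Re z \<le> b \<and> Im z = v}"
proof (rule closed_segment_subset)
  have "{z. a \<le> Re z \<and> Re z \<le> b \<and> Im z = v} = {z. Re z \<ge> a} \<inter> ({z. Re z \<le> b} \<inter> ({z. Im z \<ge> v} \<inter> {z. Im z \<le> v}))"
    by auto
  then show "convex {z. a \<le> Re z \<and> Re z \<le> b \<and> Im z = v}"
    by (simp add: convex_Int convex_halfspace_Re_ge convex_halfspace_Re_le convex_halfspace_Im_ge convex_halfspace_Im_le)
qed (use assms in auto)

text \<open>A holomorphic function on the convex half-plane has a primitive \<open>\<Phi>\<close>,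
  so truncated integrals along two vertical lines differ only by increments of \<open>\<Phi>\<close>
  along horizontal segments of length at most 1, which \<open>W\<close> bounds. Hence the integral
  is the same for all p in (0, 1], and the limit as p tends to 0 is dominated by \<open>W\<close>.
  The majorant may be unbounded near v = 0 as long as it is integrable, which admits a singularity
  of \<open>f\<close> at the origin.\<close>

lemma integral_vertical_halfplane_eq_limit:
  fixes f :: "complex \<Rightarrow> complex" and W :: "real \<Rightarrow> real" and f0 :: "real \<Rightarrow> complex"
  assumes holo: "f holomorphic_on {z. Re z > 0}"
    and bound: "\<And>p v. 0 < p \<Longrightarrow> p \<le> 1 \<Longrightarrow> v \<noteq> 0 \<Longrightarrow> norm (f (Complex p v)) \<le> W \<bar>v\<bar>"
    and W_int: "integrable lborel (\<lambda>v. W \<bar>v\<bar>)" and W_lim: "(W \<longlongrightarrow> 0) at_top"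
    and f0_meas [measurable]: "f0 \<in> borel_measurable borel"
    and lim: "\<And>v. v \<noteq> 0 \<Longrightarrow> ((\<lambda>p. f (Complex p v)) \<longlongrightarrow> f0 v) (at_right 0)"
  shows "integrable lborel (\<lambda>v. f (Complex 1 v))"
    and "(LINT v|lborel. f (Complex 1 v)) = (LINT v|lborel. f0 v)"
proof -
  have cont: "continuous_on UNIV (\<lambda>v. f (Complex p v))" if "p > 0" for p
    by (rule continuous_on_compose2[OF holomorphic_on_imp_continuous_on[OF holo]])
      (use that in \<open>auto simp: Complex_eq intro!: continuous_intros\<close>)
  have meas[measurable]: "(\<lambda>v. f (Complex p v)) \<in> borel_measurable borel" if "p > 0" for p
    by (rule borel_measurable_continuous_onI[OF cont[OF that]])
  have AE0: "AE v in lborel. v \<noteq> (0::real)" by (rule AE_lborel_singleton)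
  have bAE: "AE v in lborel. norm (f (Complex p v)) \<le> W \<bar>v\<bar>" if "0 < p" "p \<le> 1" for p
    using AE0 by eventually_elim (rule bound[OF that])
  have int: "integrable lborel (\<lambda>v. f (Complex p v))" if "0 < p" "p \<le> 1" for p
    by (rule Bochner_Integration.integrable_bound[OF W_int])
      (use that meas bAE[OF that] in \<open>auto elim!: eventually_mono intro: order_trans[OF _ abs_ge_self]\<close>)
  show "integrable lborel (\<lambda>v. f (Complex 1 v))" by (rule int) auto
  have convex: "convex {z. Re z > 0}" by (rule convex_halfspace_Re_gt)
  obtain \<Phi> where \<Phi>: "\<And>z. Re z > 0 \<Longrightarrow> (\<Phi> has_field_derivative f z) (at z)"
  proof -
    obtain g where g: "\<And>z. z \<in> {z. Re z > 0} \<Longrightarrow> (g has_field_derivative f z) (at z within {z. Re z > 0})"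
      using holomorphic_convex_primitive'[OF convex open_halfspace_Re_gt holo] by blast
    show thesis
      by (rule that[of g]) (use g at_within_open[OF _ open_halfspace_Re_gt] in fastforce)
  qed
  have trunc_lim: "(\<lambda>n. LINT v|lborel. indicator {- real n..real n} v *\<^sub>R f (Complex p v)) \<longlonglongrightarrow> (LINT v|lborel. f (Complex p v))"
    if p: "0 < p" "p \<le> 1" for p
  proof (rule integral_dominated_convergence)
    show "integrable lborel (\<lambda>v. norm (f (Complex p v)))" using int[OF p] by auto
    show "AE v in lborel. (\<lambda>n. indicator {- real n..real n} v *\<^sub>R f (Complex p v)) \<longlonglongrightarrow> f (Complex p v)"
    proof (rule AE_I2)
      fix v :: real
      obtain N :: nat where "\<bar>v\<bar> < real N" using reals_Archimedean2 by blast
      then have "eventually (\<lambda>n. indicator {- real n..real n} v *\<^sub>R f (Complex p v) = f (Complex p v)) sequentially"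
        by (intro eventually_sequentiallyI[of N]) (auto split: split_indicator)
      then show "(\<lambda>n. indicator {- real n..real n} v *\<^sub>R f (Complex p v)) \<longlonglongrightarrow> f (Complex p v)"
        by (rule tendsto_eventually)
    qed
  qed (use p meas in \<open>auto split: split_indicator\<close>)
  \<comment> \<open>Along the line d\<zeta> = \<i> dv, so the primitive with respect to v is
    \<open>- \<i> * \<Phi>\<close>.\<close>
  have trunc: "(LINT v|lborel. indicator {- real n..real n} v *\<^sub>R f (Complex p v)) = - \<i> * \<Phi> (Complex p (real n)) - (- \<i> * \<Phi> (Complex p (- real n)))"
    if p: "0 < p" for p n
  proof (rule integral_FTC_Icc)
    fix v :: real
    have 1: "((\<lambda>z. - \<i> * \<Phi> z) has_field_derivative (- \<i> * f (Complex p v))) (at (Complex p v))"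
      using \<Phi>[of "Complex p v"] p by (intro DERIV_cmult) auto
    have 2: "((\<lambda>v. Complex p v) has_vector_derivative \<i>) (at v within {- real n..real n})"
      unfolding Complex_eq by (auto intro!: derivative_eq_intros)
    have "(((\<lambda>z. - \<i> * \<Phi> z) \<circ> (\<lambda>v. Complex p v)) has_vector_derivative (\<i> * (- \<i> * f (Complex p v)))) (at v within {- real n..real n})"
      by (rule field_vector_diff_chain_within[OF 2 has_field_derivative_at_within[OF 1]])
    then show "((\<lambda>v. - \<i> * \<Phi> (Complex p v)) has_vector_derivative f (Complex p v)) (at v within {- real n..real n})"
      by (simp add: o_def)
  qed (use p in \<open>auto intro: continuous_on_subset[OF cont]\<close>)
  have horiz: "norm (\<Phi> (Complex p v) - \<Phi> (Complex 1 v)) \<le> W \<bar>v\<bar>" if p: "0 < p" "p \<le> 1" and v: "v \<noteq> 0" for p v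
  proof -
    have seg: "closed_segment (Complex p v) (Complex 1 v) \<subseteq> {z. p \<le> Re z \<and> Re z \<le> 1 \<and> Im z = v}"
      by (rule closed_segment_horizontal) (use p in auto)
    have "norm (\<Phi> (Complex p v) - \<Phi> (Complex 1 v)) \<le> W \<bar>v\<bar> * norm (Complex p v - Complex 1 v)"
    proof (rule field_differentiable_bound[OF convex_closed_segment])
      fix z assume "z \<in> closed_segment (Complex p v) (Complex 1 v)"
      then have z: "p \<le> Re z" "Re z \<le> 1" "z = Complex (Re z) v" using seg by (auto simp: complex_eq_iff)
      show "(\<Phi> has_field_derivative f z) (at z within closed_segment (Complex p v) (Complex 1 v))"
        using \<Phi>[of z] z p by (auto intro: has_field_derivative_at_within)
      show "norm (f z) \<le> W \<bar>v\<bar>"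
        using bound[of "Re z" v] z p v by (metis order_less_le_trans)
    qed auto
    also have "\<dots> \<le> W \<bar>v\<bar> * 1"
    proof (rule mult_left_mono)
      have "norm (Complex p v - Complex 1 v) = \<bar>p - 1\<bar>" by (simp add: cmod_def)
      then show "norm (Complex p v - Complex 1 v) \<le> 1" using p by simp
      show "0 \<le> W \<bar>v\<bar>" using bound[of 1 v] v by (auto intro: order_trans[OF norm_ge_zero])
    qed
    finally show ?thesis by simp
  qed
  have indep: "(LINT v|lborel. f (Complex p v)) = (LINT v|lborel. f (Complex 1 v))" if p: "0 < p" "p \<le> 1" for p
  proof -
    have d0: "(\<lambda>n. (LINT v|lborel. indicator {- real n..real n} v *\<^sub>R f (Complex p v)) - (LINT v|lborel. indicator {- real n..real n} v *\<^sub>R f (Complex 1 v))) \<longlonglongrightarrow> 0"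
    proof (rule Lim_null_comparison)
      show "eventually (\<lambda>n. norm ((LINT v|lborel. indicator {- real n..real n} v *\<^sub>R f (Complex p v)) - (LINT v|lborel. indicator {- real n..real n} v *\<^sub>R f (Complex 1 v))) \<le> W (real n) + W (real n)) sequentially"
      proof (rule eventually_sequentiallyI[of 1])
        fix n :: nat assume n: "1 \<le> n"
        have "(LINT v|lborel. indicator {- real n..real n} v *\<^sub>R f (Complex p v)) - (LINT v|lborel. indicator {- real n..real n} v *\<^sub>R f (Complex 1 v))
          = - \<i> * (\<Phi> (Complex p (real n)) - \<Phi> (Complex 1 (real n))) - (- \<i> * (\<Phi> (Complex p (- real n)) - \<Phi> (Complex 1 (- real n))))"
          using p by (simp add: trunc algebra_simps)
        also have "norm \<dots> \<le> norm (\<Phi> (Complex p (real n)) - \<Phi> (Complex 1 (real n))) + norm (\<Phi> (Complex p (- real n)) - \<Phi> (Complex 1 (- real n)))"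
          by (rule order_trans[OF norm_triangle_ineq4]) (simp add: norm_mult)
        also have "\<dots> \<le> W (real n) + W (real n)"
          using horiz[OF p, of "real n"] horiz[OF p, of "- real n"] n by (intro add_mono) auto
        finally show "norm ((LINT v|lborel. indicator {- real n..real n} v *\<^sub>R f (Complex p v)) - (LINT v|lborel. indicator {- real n..real n} v *\<^sub>R f (Complex 1 v))) \<le> W (real n) + W (real n)" .
      qed
      have "(\<lambda>n. W (real n)) \<longlonglongrightarrow> 0"
        using W_lim filterlim_real_sequentially by (rule filterlim_compose)
      from tendsto_add[OF this this] show "(\<lambda>n. W (real n) + W (real n)) \<longlonglongrightarrow> 0" by simp
    qed
    have "(\<lambda>n. (LINT v|lborel. indicator {- real n..real n} v *\<^sub>R f (Complex p v)) - (LINT v|lborel. indicator {- real n..real n} v *\<^sub>R f (Complex 1 v))) \<longlonglongrightarrow> (LINT v|lborel. f (Complex p v)) - (LINT v|lborel. f (Complex 1 v))"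
      by (intro tendsto_diff trunc_lim) (use p in auto)
    from LIMSEQ_unique[OF this d0] show ?thesis by simp
  qed
  define p where "p = (\<lambda>n. inverse (real (Suc n)))"
  have p: "0 < p n" "p n \<le> 1" for n by (auto simp: p_def inverse_le_1_iff)
  have plim: "filterlim p (at_right 0) sequentially"
    unfolding filterlim_at using p LIMSEQ_inverse_real_of_nat by (auto simp: p_def)
  have "(\<lambda>n. LINT v|lborel. f (Complex (p n) v)) \<longlonglongrightarrow> (LINT v|lborel. f0 v)"
  proof (rule integral_dominated_convergence[OF _ _ W_int])
    show "AE v in lborel. (\<lambda>n. f (Complex (p n) v)) \<longlonglongrightarrow> f0 v"
      using AE0 by eventually_elim (rule filterlim_compose[OF lim plim])
    show "AE v in lborel. norm (f (Complex (p n) v)) \<le> W \<bar>v\<bar>" for n by (rule bAE[OF p])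
  qed (use p meas in auto)
  then have "(\<lambda>n. LINT v|lborel. f (Complex 1 v)) \<longlonglongrightarrow> (LINT v|lborel. f0 v)"
    by (simp add: indep[OF p])
  then show "(LINT v|lborel. f (Complex 1 v)) = (LINT v|lborel. f0 v)"
    by (simp add: LIMSEQ_const_iff)
qed

section \<open>The stable exponent near the imaginary axis\<close>

lemma powr_ii_axis:
  assumes "v \<noteq> (0::real)"
  shows "Complex 0 v powr w = exp (w * (complex_of_real (ln \<bar>v\<bar>) + \<i> * complex_of_real (sgn v * pi / 2)))"
proof -
  have "Ln (Complex 0 v) = complex_of_real (ln \<bar>v\<bar>) + \<i> * complex_of_real (sgn v * pi / 2)"
  proof (cases "v > 0")
    case True
    have "Complex 0 v = of_real v * \<i>" by (simp add: complex_eq_iff)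
    then show ?thesis using True by (simp add: Ln_times_of_real Ln_of_real)
  next
    case False
    have "Complex 0 v = of_real (- v) * (- \<i>)" by (simp add: complex_eq_iff)
    then show ?thesis using False assms Ln_times_of_real[of "- v" "- \<i>"] Ln_of_real[of "- v"] by simp
  qed
  moreover have "Complex 0 v \<noteq> 0" using assms by (simp add: complex_eq_iff)
  ultimately show ?thesis by (simp add: powr_def)
qed

text \<open>The angle lies in (pi / 2, pi]. This sign makes \<mu> negative, hence m positive, and it
  makes \<open>exp (m * (\<i> v) powr \<alpha>)\<close> decay.\<close>

lemma cos_half_pi_neg:
  assumes "1 < \<alpha>" "\<alpha> \<le> 2"
  shows "cos (\<alpha> * pi / 2) < 0"
proof -
  have "cos (\<alpha> * pi / 2) = - sin (\<alpha> * pi / 2 - pi / 2)"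
    by (simp add: sin_diff)
  moreover have "sin (\<alpha> * pi / 2 - pi / 2) > 0"
  proof (rule sin_gt_zero)
    show "0 < \<alpha> * pi / 2 - pi / 2" using assms by simp
    have "\<alpha> * pi / 2 \<le> 2 * pi / 2" using assms by (intro divide_right_mono mult_right_mono) auto
    then show "\<alpha> * pi / 2 - pi / 2 < pi" using pi_gt_zero by linarith
  qed
  ultimately show ?thesis by simp
qed

text \<open>On the axis the real part is \<open>- \<kappa> * \<bar>v\<bar> powr \<alpha>\<close>
  with \<kappa> > 0. Moving horizontally by at most 1 changes the power by at most
  \<open>\<alpha> * (1 + \<bar>v\<bar>)\<close>, by the mean value inequality and \<alpha> - 1 <= 1.
  As \<alpha> > 1, the negative term absorbs this linear error and still leaves the slope -
  1.\<close>

lemma Re_powr_strip_le: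
  assumes al: "1 < \<alpha>" "\<alpha> \<le> 2"
  shows "\<exists>B. \<forall>p v. 0 < p \<longrightarrow> p \<le> 1 \<longrightarrow> v \<noteq> 0 \<longrightarrow>
     Re (Complex p v powr complex_of_real \<alpha>) \<le> B - \<bar>v\<bar>"
proof -
  define \<kappa> where "\<kappa> = - cos (\<alpha> * pi / 2)"
  have \<kappa>: "\<kappa> > 0" using cos_half_pi_neg[OF al] by (simp add: \<kappa>_def)
  \<comment> \<open>T solves \<open>\<kappa> * T powr (\<alpha> - 1) = \<alpha> + 1\<close>; beyond
    it \<open>\<kappa> * t powr \<alpha>\<close> exceeds \<open>(\<alpha> + 1) * t\<close>. The
    slope \<alpha> + 1 is \<alpha> from the mean value bound plus 1 for the decay that is
    kept.\<close>
  define T where "T = ((\<alpha> + 1) / \<kappa>) powr (1 / (\<alpha> - 1))"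
  have T: "T > 0" unfolding T_def using \<kappa> al by simp
  have lin: "(\<alpha> + 1) * t - \<kappa> * t powr \<alpha> \<le> (\<alpha> + 1) * T" if t: "t > 0" for t
  proof (cases "t \<le> T")
    case True
    have "0 \<le> \<kappa> * t powr \<alpha>" using \<kappa> by simp
    moreover have "(\<alpha> + 1) * t \<le> (\<alpha> + 1) * T" using True al by simp
    ultimately show ?thesis by linarith
  next
    case False
    have "T powr (\<alpha> - 1) = (\<alpha> + 1) / \<kappa>" unfolding T_def using al \<kappa> by (simp add: powr_powr)
    moreover have "T powr (\<alpha> - 1) \<le> t powr (\<alpha> - 1)"
      using False T al by (intro powr_mono2) auto
    ultimately have "(\<alpha> + 1) / \<kappa> \<le> t powr (\<alpha> - 1)" by simp
    then have "\<alpha> + 1 \<le> \<kappa> * t powr (\<alpha> - 1)" using \<kappa> by (simp add: pos_divide_le_eq mult.commute)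
    then have "(\<alpha> + 1) * t \<le> (\<kappa> * t powr (\<alpha> - 1)) * t" using t by (intro mult_right_mono) auto
    also have "\<dots> = \<kappa> * t powr \<alpha>" using t by (simp add: powr_diff)
    finally show ?thesis using T al by (smt (verit) mult_pos_pos)
  qed
  have "Re (Complex p v powr complex_of_real \<alpha>) \<le> (\<alpha> + (\<alpha> + 1) * T) - \<bar>v\<bar>" if p: "0 < p" "p \<le> 1" and v: "v \<noteq> 0" for p v
  proof -
    define S where "S = closed_segment (Complex 0 v) (Complex p v)"
    have seg: "S \<subseteq> {z. 0 \<le> Re z \<and> Re z \<le> p \<and> Im z = v}"
      unfolding S_def by (rule closed_segment_horizontal) (use p in auto)
    have "norm (Complex p v powr complex_of_real \<alpha> - Complex 0 v powr complex_of_real \<alpha>) \<le> (\<alpha> * (1 + \<bar>v\<bar>)) * norm (Complex p v - Complex 0 v)"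
    proof (rule field_differentiable_bound[of S])
      fix z assume "z \<in> S"
      then have z: "0 \<le> Re z" "Re z \<le> p" "Im z = v" using seg by auto
      have nz: "z \<notin> \<real>\<^sub>\<le>\<^sub>0" using z v by (auto simp: complex_nonpos_Reals_iff)
      show "((\<lambda>z. z powr complex_of_real \<alpha>) has_field_derivative complex_of_real \<alpha> * z powr (complex_of_real \<alpha> - 1)) (at z within S)"
        by (rule has_field_derivative_at_within[OF has_field_derivative_powr[OF nz]])
      have nle: "norm z \<le> 1 + \<bar>v\<bar>" using cmod_le[of z] z p by simp
      have "norm (z powr (complex_of_real \<alpha> - 1)) = norm z powr (\<alpha> - 1)"
        using norm_powr_real_powr'[of "\<alpha> - 1" z] by simp
      also have "\<dots> \<le> (1 + \<bar>v\<bar>) powr (\<alpha> - 1)" using nle al by (intro powr_mono2) auto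
      also have "\<dots> \<le> (1 + \<bar>v\<bar>) powr 1" using al by (intro powr_mono) auto
      finally show "norm (complex_of_real \<alpha> * z powr (complex_of_real \<alpha> - 1)) \<le> \<alpha> * (1 + \<bar>v\<bar>)"
        using al by (simp add: norm_mult mult_left_mono)
    qed (auto simp: S_def)
    also have "\<dots> \<le> (\<alpha> * (1 + \<bar>v\<bar>)) * 1"
    proof (rule mult_left_mono)
      have "norm (Complex p v - Complex 0 v) = \<bar>p\<bar>" by (simp add: cmod_def)
      then show "norm (Complex p v - Complex 0 v) \<le> 1" using p by simp
    qed (use al in auto)
    finally have "Re (Complex p v powr complex_of_real \<alpha>) - Re (Complex 0 v powr complex_of_real \<alpha>) \<le> \<alpha> * (1 + \<bar>v\<bar>)"
      using complex_Re_le_cmod order_trans by (metis mult.right_neutral minus_complex.sel(1))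
    moreover have "Re (Complex 0 v powr complex_of_real \<alpha>) = - \<kappa> * \<bar>v\<bar> powr \<alpha>"
    proof -
      have "cos (\<alpha> * (sgn v * pi / 2)) = cos (\<alpha> * pi / 2)" using v by (cases "v > 0") auto
      then show ?thesis using v unfolding powr_ii_axis[OF v] \<kappa>_def by (simp add: Re_exp powr_def)
    qed
    moreover have "(\<alpha> + 1) * \<bar>v\<bar> - \<kappa> * \<bar>v\<bar> powr \<alpha> \<le> (\<alpha> + 1) * T" using lin v by simp
    ultimately show ?thesis by (simp add: algebra_simps)
  qed
  then show ?thesis by blast
qed

lemma exp_powr_strip_bound:
  assumes al: "1 < \<alpha>" "\<alpha> \<le> 2" and m: "m > 0"
  shows "\<exists>A. A > 0 \<and> (\<forall>p v. 0 < p \<longrightarrow> p \<le> 1 \<longrightarrow> v \<noteq> 0 \<longrightarrow>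
     norm (exp (complex_of_real m * Complex p v powr complex_of_real \<alpha>)) \<le> A * exp (- m * \<bar>v\<bar>))"
proof -
  obtain B where B: "Re (Complex p v powr complex_of_real \<alpha>) \<le> B - \<bar>v\<bar>" if "0 < p" "p \<le> 1" "v \<noteq> 0" for p v
    using Re_powr_strip_le[OF al] by blast
  have "norm (exp (complex_of_real m * Complex p v powr complex_of_real \<alpha>)) \<le> exp (m * B) * exp (- m * \<bar>v\<bar>)"
    if "0 < p" "p \<le> 1" "v \<noteq> 0" for p v
    using mult_left_mono[OF B[OF that], of m] m by (simp add: mult_exp_exp algebra_simps)
  then show ?thesis by (intro exI[of _ "exp (m * B)"]) auto
qed

lemma continuous_on_powr_vertical:
  assumes "p > 0"
  shows "continuous_on UNIV (\<lambda>v. Complex p v powr w)"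
proof (rule continuous_at_imp_continuous_on, rule ballI)
  fix v
  have "Complex p v \<notin> \<real>\<^sub>\<le>\<^sub>0" using assms by (auto simp: complex_nonpos_Reals_iff)
  moreover have "isCont (\<lambda>v. Complex p v) v" unfolding Complex_eq by (intro continuous_intros)
  ultimately show "isCont (\<lambda>v. Complex p v powr w) v" by (intro isCont_powr_complex) auto
qed

lemma tendsto_powr_axis:
  assumes "v \<noteq> 0"
  shows "((\<lambda>p. Complex p v powr w) \<longlongrightarrow> Complex 0 v powr w) (at_right 0)"
proof -
  have "Complex 0 v \<notin> \<real>\<^sub>\<le>\<^sub>0" using assms by (auto simp: complex_nonpos_Reals_iff)
  moreover have "isCont (\<lambda>p. Complex p v) 0" unfolding Complex_eq by (intro continuous_intros)
  ultimately have "isCont (\<lambda>p. Complex p v powr w) 0" by (intro isCont_powr_complex) auto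
  then show ?thesis unfolding isCont_def by (rule tendsto_within_subset) auto
qed

lemma holomorphic_on_powr_halfplane:
  "(\<lambda>z. z powr w) holomorphic_on {z. Re z > 0}"
proof (rule holomorphic_on_subset)
  show "(\<lambda>z. z powr w) holomorphic_on (- \<real>\<^sub>\<le>\<^sub>0)"
    using has_field_derivative_powr open_Compl[OF closed_nonpos_Reals_complex] by (subst holomorphic_on_open) blast+
qed (auto simp: complex_nonpos_Reals_iff)

text \<open>For x >= 0 the factor \<open>exp (- (\<zeta> * x))\<close> has modulus at most 1 in the
  strip, so the bound on the stable factor alone serves as majorant. The function
  \<open>\<phi>\<close> stands for the characteristic function; k = 0 is left out because the branch
  point of the power lies there.\<close>

lemma fourier_integral_eq_vertical:
  assumes al: "1 < \<alpha>" "\<alpha> \<le> 2" and m: "m > 0" and x: "x \<ge> 0"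
    and \<phi>_meas[measurable]: "\<phi> \<in> borel_measurable borel"
    and \<phi>: "\<And>k. k \<noteq> 0 \<Longrightarrow> \<phi> k = exp (complex_of_real m * Complex 0 k powr complex_of_real \<alpha>)"
  shows "(CLINT k|lborel. \<phi> k * iexp (- (k * x))) =
     (CLINT v|lborel. exp (complex_of_real m * Complex 1 v powr complex_of_real \<alpha>) * exp (- (Complex 1 v * complex_of_real x)))"
proof -
  obtain A where A: "A > 0" "\<And>p v. 0 < p \<Longrightarrow> p \<le> 1 \<Longrightarrow> v \<noteq> 0 \<Longrightarrow>
     norm (exp (complex_of_real m * Complex p v powr complex_of_real \<alpha>)) \<le> A * exp (- m * \<bar>v\<bar>)"
    using exp_powr_strip_bound[OF al m] by blast
  show ?thesis
  proof (rule integral_vertical_halfplane_eq_limit(2)[where W = "\<lambda>v. A * exp (- m * v)", symmetric])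
    show "(\<lambda>z. exp (complex_of_real m * z powr complex_of_real \<alpha>) * exp (- (z * complex_of_real x))) holomorphic_on {z. Re z > 0}"
      by (intro holomorphic_intros holomorphic_on_powr_halfplane)
    show "integrable lborel (\<lambda>v. A * exp (- m * \<bar>v\<bar>))" using integrable_exp_abs[OF m] by simp
    show "((\<lambda>v. A * exp (- m * v)) \<longlongrightarrow> 0) at_top" using m by real_asymp
    fix p v :: real assume pv: "0 < p" "p \<le> 1" "v \<noteq> 0"
    have "norm (exp (- (Complex p v * complex_of_real x))) \<le> 1" using pv x by simp
    then show "norm (exp (complex_of_real m * Complex p v powr complex_of_real \<alpha>) * exp (- (Complex p v * complex_of_real x))) \<le> A * exp (- m * \<bar>v\<bar>)"
      unfolding norm_mult
      using mult_mono[OF A(2)[OF pv], of "norm (exp (- (Complex p v * complex_of_real x)))" 1] A(1) by simp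
  next
    fix v :: real assume v: "v \<noteq> 0"
    have e: "iexp (- (v * x)) = exp (- (Complex 0 v * complex_of_real x))"
      by (simp add: Complex_eq mult_ac)
    show "((\<lambda>p. exp (complex_of_real m * Complex p v powr complex_of_real \<alpha>) * exp (- (Complex p v * complex_of_real x))) \<longlongrightarrow> \<phi> v * iexp (- (v * x))) (at_right 0)"
      unfolding \<phi>[OF v] e
      by (intro tendsto_mult tendsto_exp tendsto_const tendsto_powr_axis tendsto_minus v)
        (auto simp: Complex_eq intro!: tendsto_eq_intros)
  qed measurable
qed

section \<open>The line integral \<open>J z\<close> and its closed form\<close>

lemma norm_powr_complex_le:
  assumes "z \<noteq> 0"
  shows "norm (z powr w) \<le> norm z powr Re w * exp (pi * \<bar>Im w\<bar>)"
proof -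
  have norm_eq: "norm (z powr w) = norm z powr Re w * exp (- Im w * Im (Ln z))"
    using assms by (simp add: powr_def mult_exp_exp)
  have "- Im w * Im (Ln z) \<le> \<bar>Im w\<bar> * \<bar>Im (Ln z)\<bar>"
    by (metis abs_ge_self abs_minus_cancel abs_mult)
  also have "\<dots> \<le> \<bar>Im w\<bar> * pi"
    using mpi_less_Im_Ln[OF assms] Im_Ln_le_pi[OF assms] by (intro mult_left_mono) auto
  finally have "exp (- Im w * Im (Ln z)) \<le> exp (pi * \<bar>Im w\<bar>)" by (simp add: mult.commute)
  then have "norm z powr Re w * exp (- Im w * Im (Ln z)) \<le> norm z powr Re w * exp (pi * \<bar>Im w\<bar>)"
    by (intro mult_left_mono) auto
  with norm_eq show ?thesis by simp
qed

text \<open>This is the substitution t = v^\<alpha> in Euler's integral with exponent - z /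
  \<alpha>. On the logarithmic scale it is multiplication by \<alpha>, so the proof passes to
  logarithms, rescales and passes back.\<close>

lemma stretched_Gamma_integral:
  fixes z :: complex
  assumes al: "\<alpha> > 0" and z: "Re z < 0" and b: "Re b > 0"
  shows "has_bochner_integral lborel
    (\<lambda>v. indicator {0<..} v *\<^sub>R (exp ((- 1 - z) * complex_of_real (ln v)) * exp (- (b * exp (complex_of_real \<alpha> * complex_of_real (ln v))))))
    (Gamma (- z / \<alpha>) * b powr (z / \<alpha>) / \<alpha>)"
proof -
  define s where "s = - z / complex_of_real \<alpha>"
  have s: "Re s > 0" using al z by (simp add: s_def divide_neg_pos)
  define h where "h = (\<lambda>x. exp x *\<^sub>R (exp ((s - 1) * complex_of_real (ln (exp x))) * exp (- (b * complex_of_real (exp x)))))"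
  have "has_bochner_integral lborel h (Gamma s * b powr (- s))"
    unfolding h_def
    by (rule has_bochner_integral_exp_substitution[THEN iffD1, OF _ Gamma_integral_halfplane[OF s b]]) measurable
  then have "has_bochner_integral lborel (\<lambda>y. h (0 + \<alpha> * y)) ((Gamma s * b powr (- s)) /\<^sub>R \<bar>\<alpha>\<bar>)"
    using lborel_has_bochner_integral_real_affine_iff[of \<alpha> h _ 0] al by simp
  also have "(\<lambda>y. h (0 + \<alpha> * y)) = (\<lambda>y. exp y *\<^sub>R (exp ((- 1 - z) * complex_of_real (ln (exp y))) * exp (- (b * exp (complex_of_real \<alpha> * complex_of_real (ln (exp y)))))))"
  proof
    fix y
    have "exp (\<alpha> * y) *\<^sub>R exp ((s - 1) * complex_of_real (\<alpha> * y)) = exp y *\<^sub>R exp ((- 1 - z) * complex_of_real y)"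
      using al by (simp add: scaleR_conv_of_real exp_of_real[symmetric] mult_exp_exp s_def algebra_simps)
    then show "h (0 + \<alpha> * y) = exp y *\<^sub>R (exp ((- 1 - z) * complex_of_real (ln (exp y))) * exp (- (b * exp (complex_of_real \<alpha> * complex_of_real (ln (exp y))))))"
      by (simp add: h_def exp_of_real[symmetric] mult_scaleR_left[symmetric] del: mult_scaleR_left)
  qed
  finally have "has_bochner_integral lborel (\<lambda>v. indicator {0<..} v *\<^sub>R (exp ((- 1 - z) * complex_of_real (ln v)) * exp (- (b * exp (complex_of_real \<alpha> * complex_of_real (ln v)))))) ((Gamma s * b powr (- s)) /\<^sub>R \<bar>\<alpha>\<bar>)"
    by (rule has_bochner_integral_exp_substitution[THEN iffD2, rotated]) measurable
  then show ?thesis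
    using al by (simp add: s_def scaleR_conv_of_real divide_inverse mult.commute)
qed

text \<open>The two half-axes, with arguments \<open>e * pi / 2\<close> for e = 1 and e = - 1, each
  reduce to a stretched Gamma integral with a complex coefficient \<open>b e\<close>. Their phases
  add up to a multiple of \<open>sin (pi * z / \<alpha>)\<close>, and reflection turns its product
  with \<open>\<Gamma> (- z / \<alpha>)\<close> into a reciprocal Gamma value.\<close>

lemma integral_imaginary_axis:
  fixes z :: complex
  assumes al: "1 < \<alpha>" "\<alpha> \<le> 2" and m: "m > 0" and z: "Re z < 0"
  shows "(LINT v|lborel. exp ((- 1 - z) * (complex_of_real (ln \<bar>v\<bar>) + \<i> * complex_of_real (sgn v * pi / 2)))
      * exp (complex_of_real m * exp (complex_of_real \<alpha> * (complex_of_real (ln \<bar>v\<bar>) + \<i> * complex_of_real (sgn v * pi / 2)))))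
    = 2 * pi * exp (z / \<alpha> * complex_of_real (ln m)) * rGamma (1 + z / \<alpha>) / \<alpha>"
  (is "(LINT v|lborel. ?f v) = _")
proof -
  define q where "q = (\<lambda>e::real. exp ((- 1 - z) * (\<i> * complex_of_real (e * pi / 2))))"
  \<comment> \<open>This is \<open>- m * exp (\<i> * \<alpha> * e * pi / 2)\<close> with the minus
    sign absorbed into the argument. For e = 1 the argument \<alpha> pi / 2 - pi lies in (- pi / 2,
    0], for e = - 1 it is the opposite; so \<open>b e\<close> has positive real part and its
    principal logarithm can be read off.\<close>
  define b where "b = (\<lambda>e::real. exp (complex_of_real (ln m) + \<i> * complex_of_real (e * (\<alpha> * pi / 2 - pi))))"
  define h where "h = (\<lambda>e v. indicator {0<..} v *\<^sub>R (exp ((- 1 - z) * complex_of_real (ln v)) * exp (- (b e * exp (complex_of_real \<alpha> * complex_of_real (ln v))))))"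
  define I where "I = (\<lambda>e. Gamma (- z / \<alpha>) * b e powr (z / \<alpha>) / \<alpha>)"
  have ang: "- pi / 2 < \<alpha> * pi / 2 - pi" "\<alpha> * pi / 2 - pi \<le> 0"
  proof -
    have "1 * pi < \<alpha> * pi" "\<alpha> * pi \<le> 2 * pi" using al by (intro mult_strict_right_mono mult_right_mono; simp)+
    then show "- pi / 2 < \<alpha> * pi / 2 - pi" "\<alpha> * pi / 2 - pi \<le> 0" by linarith+
  qed
  have b_pos: "Re (b e) > 0" if "e = 1 \<or> e = - 1" for e
  proof -
    have "cos (e * (\<alpha> * pi / 2 - pi)) = cos (\<alpha> * pi / 2 - pi)"
      using that by (metis cos_minus mult_1 mult_minus1)
    also have "\<dots> > 0" by (rule cos_gt_zero_pi) (use ang pi_gt_zero in linarith)+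
    finally show ?thesis by (simp add: b_def Re_exp)
  qed
  have b_neg: "b e = - complex_of_real m * exp (complex_of_real \<alpha> * (\<i> * complex_of_real (e * pi / 2)))" if "e = 1 \<or> e = - 1" for e
  proof -
    have "exp (\<i> * complex_of_real (e * (\<alpha> * pi / 2 - pi))) = exp (complex_of_real \<alpha> * (\<i> * complex_of_real (e * pi / 2))) * exp (\<i> * complex_of_real (- e * pi))"
      by (simp add: mult_exp_exp algebra_simps)
    also have "exp (\<i> * complex_of_real (- e * pi)) = - 1"
      using that by (auto simp: exp_minus)
    finally show ?thesis using m unfolding b_def exp_add by (simp add: exp_of_real)
  qed
  have hI: "has_bochner_integral lborel (h e) (I e)" if "e = 1 \<or> e = - 1" for e
    unfolding h_def I_def by (rule stretched_Gamma_integral) (use al z b_pos[OF that] in auto)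
  have hI': "has_bochner_integral lborel (\<lambda>v. h e (- v)) (I e)" if "e = 1 \<or> e = - 1" for e
    using lborel_has_bochner_integral_real_affine_iff[of "-1" "h e" "I e" 0] hI[OF that] by simp
  have sum: "has_bochner_integral lborel (\<lambda>v. q 1 * h 1 v + q (- 1) * h (- 1) (- v)) (q 1 * I 1 + q (- 1) * I (- 1))"
    by (intro has_bochner_integral_add has_bochner_integral_mult_right hI hI') auto
  have side: "exp ((- 1 - z) * (complex_of_real l + \<i> * complex_of_real (e * pi / 2)))
      * exp (complex_of_real m * exp (complex_of_real \<alpha> * (complex_of_real l + \<i> * complex_of_real (e * pi / 2))))
      = q e * (exp ((- 1 - z) * complex_of_real l) * exp (- (b e * exp (complex_of_real \<alpha> * complex_of_real l))))" if "e = 1 \<or> e = - 1" for e l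
    unfolding b_neg[OF that] q_def
    by (simp only: distrib_left exp_add) (simp add: mult_ac)
  have "?f v = q 1 * h 1 v + q (- 1) * h (- 1) (- v)" if "v \<noteq> 0" for v
  proof (cases "v > 0")
    case True
    then show ?thesis using side[of 1 "ln v"] by (simp add: h_def)
  next
    case False
    then show ?thesis using that side[of "- 1" "ln (- v)"] by (simp add: h_def)
  qed
  moreover have "AE v in lborel. v \<noteq> (0::real)" by (rule AE_lborel_singleton)
  ultimately have AE: "AE v in lborel. ?f v = q 1 * h 1 v + q (- 1) * h (- 1) (- v)" by auto
  have meas: "(\<lambda>v. q 1 * h 1 v + q (- 1) * h (- 1) (- v)) \<in> borel_measurable lborel"
    unfolding h_def by measurable
  have "(LINT v|lborel. ?f v) = (LINT v|lborel. q 1 * h 1 v + q (- 1) * h (- 1) (- v))"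
    by (rule integral_cong_AE[OF _ meas AE]) measurable
  also have "\<dots> = q 1 * I 1 + q (- 1) * I (- 1)"
    by (rule has_bochner_integral_integral_eq[OF sum])
  also have "\<dots> = 2 * pi * exp (z / \<alpha> * complex_of_real (ln m)) * rGamma (1 + z / \<alpha>) / \<alpha>"
  proof -
    define w where "w = complex_of_real pi * (z / \<alpha>)"
    have pw: "q e * b e powr (z / \<alpha>) = exp (z / \<alpha> * complex_of_real (ln m)) * exp (\<i> * complex_of_real e * (- complex_of_real pi / 2 - w))" if "e = 1 \<or> e = - 1" for e
    proof -
      have "Ln (b e) = complex_of_real (ln m) + \<i> * complex_of_real (e * (\<alpha> * pi / 2 - pi))"
        unfolding b_def by (rule Ln_exp) (use that ang pi_gt_zero al in \<open>auto simp: zero_less_mult_iff zero_le_mult_iff\<close>)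
      then have "b e powr (z / \<alpha>) = exp (z / \<alpha> * (complex_of_real (ln m) + \<i> * complex_of_real (e * (\<alpha> * pi / 2 - pi))))"
        by (simp add: powr_def b_def)
      \<comment> \<open>The two terms \<open>e * z * pi / 2\<close> cancel, so that z survives in
        the phase only as pi z / \<alpha>.\<close>
      moreover have "(- 1 - z) * (\<i> * complex_of_real (e * pi / 2)) + z / \<alpha> * (complex_of_real (ln m) + \<i> * complex_of_real (e * (\<alpha> * pi / 2 - pi)))
         = z / \<alpha> * complex_of_real (ln m) + \<i> * complex_of_real e * (- complex_of_real pi / 2 - w)"
      proof -
        have "z = z / \<alpha> * complex_of_real \<alpha>" using al by simp
        then obtain y where y: "z / \<alpha> = y" "z = y * complex_of_real \<alpha>" by blast
        show ?thesis unfolding w_def y(1) unfolding y(2) by (simp add: algebra_simps flip: add_divide_distrib diff_divide_distrib)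
      qed
      ultimately show ?thesis by (simp add: q_def mult_exp_exp)
    qed
    have sn: "exp (\<i> * complex_of_real 1 * (- complex_of_real pi / 2 - w)) + exp (\<i> * complex_of_real (- 1) * (- complex_of_real pi / 2 - w)) = - 2 * sin w"
    proof -
      have "exp (\<i> * complex_of_real 1 * (- complex_of_real pi / 2 - w)) + exp (\<i> * complex_of_real (- 1) * (- complex_of_real pi / 2 - w)) = 2 * cos (- complex_of_real pi / 2 - w)"
        by (simp add: cos_exp_eq)
      also have "cos (- complex_of_real pi / 2 - w) = - sin w"
        by (simp add: cos_diff)
      finally show ?thesis by simp
    qed
    have refl: "Gamma (- z / \<alpha>) * sin w = - complex_of_real pi * rGamma (1 + z / \<alpha>)"
    proof -
      have pos: "Re (- z / \<alpha>) > 0" using z al by (simp add: divide_neg_pos)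
      have "- z / \<alpha> \<notin> \<int>\<^sub>\<le>\<^sub>0"
      proof
        assume "- z / \<alpha> \<in> \<int>\<^sub>\<le>\<^sub>0"
        then obtain n where "- z / \<alpha> = of_int n" "n \<le> 0" by (elim nonpos_Ints_cases)
        then show False using pos by simp
      qed
      then have nz: "Gamma (- z / \<alpha>) * rGamma (- z / \<alpha>) = 1"
        by (simp add: Gamma_eq_zero_iff rGamma_inverse_Gamma)
      have "rGamma (- z / \<alpha>) * rGamma (1 - (- z / \<alpha>)) = sin (of_real pi * (- z / \<alpha>)) / of_real pi"
        by (rule rGamma_reflection_complex)
      also have "sin (of_real pi * (- z / \<alpha>)) = - sin w" by (simp add: w_def)
      finally have "of_real pi * (rGamma (- z / \<alpha>) * rGamma (1 + z / \<alpha>)) = - sin w" by simp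
      then show ?thesis using nz by algebra
    qed
    have "q 1 * I 1 + q (- 1) * I (- 1) = Gamma (- z / \<alpha>) / \<alpha> * (q 1 * b 1 powr (z / \<alpha>) + q (- 1) * b (- 1) powr (z / \<alpha>))"
      by (simp add: I_def distrib_left add_divide_distrib mult_ac)
    also have "q 1 * b 1 powr (z / \<alpha>) + q (- 1) * b (- 1) powr (z / \<alpha>) = exp (z / \<alpha> * complex_of_real (ln m)) * (- 2 * sin w)"
      unfolding sn[symmetric] using pw[of 1] pw[of "- 1"] by (simp only: distrib_left simp_thms)
    also have "Gamma (- z / \<alpha>) / \<alpha> * (exp (z / \<alpha> * complex_of_real (ln m)) * (- 2 * sin w)) = - 2 * (Gamma (- z / \<alpha>) * sin w) * exp (z / \<alpha> * complex_of_real (ln m)) / \<alpha>"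
      by simp
    finally show ?thesis unfolding refl by simp
  qed
  finally show ?thesis .
qed

text \<open>The integrand of \<open>J z\<close> with respect to v rather than \<zeta>; since
  d\<zeta> = \<i> dv, the closed forms carry 2 pi instead of 2 pi \<i>.\<close>

definition vertical_kernel :: "real \<Rightarrow> real \<Rightarrow> complex \<Rightarrow> real \<Rightarrow> complex" where
  "vertical_kernel \<alpha> m z v = Complex 1 v powr (- 1 - z) * exp (complex_of_real m * Complex 1 v powr complex_of_real \<alpha>)"

lemma continuous_vertical_kernel: "continuous_on UNIV (vertical_kernel \<alpha> m z)"
  unfolding vertical_kernel_def by (intro continuous_on_mult continuous_on_exp continuous_on_const continuous_on_powr_vertical) auto

lemma integrable_linear_exp_abs:
  assumes "d > 0"
  shows "integrable lborel (\<lambda>v::real. (1 + \<bar>v\<bar>) * exp (- d * \<bar>v\<bar>))"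
  using Bochner_Integration.integrable_add[OF integrable_exp_abs[OF assms] integrable_abs_powr_exp[of 1 d]] assms
  by (simp add: distrib_right)

text \<open>For \<open>Re z >= - 2\<close> the power has modulus at most a constant times
  \<open>1 + \<bar>v\<bar>\<close> on the line. The bound - 2 fits the recurrence: from
  \<open>Re z >= 0\<close> a shift by \<alpha> <= 2 stays in this range.\<close>

lemma integrable_vertical_kernel:
  fixes z :: complex
  assumes al: "1 < \<alpha>" "\<alpha> \<le> 2" and m: "m > 0" and z: "- 2 \<le> Re z"
  shows "integrable lborel (vertical_kernel \<alpha> m z)"
proof -
  obtain A where A: "A > 0" "\<And>p v. 0 < p \<Longrightarrow> p \<le> 1 \<Longrightarrow> v \<noteq> 0 \<Longrightarrow>
     norm (exp (complex_of_real m * Complex p v powr complex_of_real \<alpha>)) \<le> A * exp (- m * \<bar>v\<bar>)"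
    using exp_powr_strip_bound[OF al m] by blast
  define D where "D = exp (pi * \<bar>Im z\<bar>)"
  show ?thesis
  proof (rule Bochner_Integration.integrable_bound)
    show "integrable lborel (\<lambda>v. D * A * ((1 + \<bar>v\<bar>) * exp (- m * \<bar>v\<bar>)))"
      using integrable_linear_exp_abs[OF m] by simp
    show "vertical_kernel \<alpha> m z \<in> borel_measurable lborel"
      using borel_measurable_continuous_onI[OF continuous_vertical_kernel] by simp
    have "norm (vertical_kernel \<alpha> m z v) \<le> D * A * ((1 + \<bar>v\<bar>) * exp (- m * \<bar>v\<bar>))" if v: "v \<noteq> 0" for v
    proof -
      have n1: "1 \<le> norm (Complex 1 v)" using abs_Re_le_cmod[of "Complex 1 v"] by simp
      have n2: "norm (Complex 1 v) \<le> 1 + \<bar>v\<bar>" using cmod_le[of "Complex 1 v"] by simp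
      have "norm (Complex 1 v powr (- 1 - z)) \<le> norm (Complex 1 v) powr (- 1 - Re z) * D"
        using norm_powr_complex_le[of "Complex 1 v" "- 1 - z"] by (simp add: D_def complex_eq_iff)
      also have "norm (Complex 1 v) powr (- 1 - Re z) \<le> norm (Complex 1 v) powr 1"
        using n1 z by (intro powr_mono) auto
      also have "\<dots> \<le> 1 + \<bar>v\<bar>" using n1 n2 by simp
      finally have "norm (Complex 1 v powr (- 1 - z)) \<le> (1 + \<bar>v\<bar>) * D"
        by (simp add: D_def)
      then have "norm (vertical_kernel \<alpha> m z v) \<le> ((1 + \<bar>v\<bar>) * D) * (A * exp (- m * \<bar>v\<bar>))"
        unfolding vertical_kernel_def norm_mult using A v by (intro mult_mono) (auto simp: D_def)
      then show ?thesis by (simp add: mult_ac)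
    qed
    moreover have "AE v in lborel. v \<noteq> (0::real)" by (rule AE_lborel_singleton)
    ultimately show "AE v in lborel. norm (vertical_kernel \<alpha> m z v) \<le> norm (D * A * ((1 + \<bar>v\<bar>) * exp (- m * \<bar>v\<bar>)))"
      by (auto elim!: eventually_mono intro: order_trans[OF _ abs_ge_self])
  qed
qed

text \<open>Near the axis the power behaves like \<open>\<bar>v\<bar> powr e\<close> with e = - 1 -
  Re z, and e > - 1, the condition for integrability at the origin, is exactly
  \<open>Re z < 0\<close>. In the majorant, \<open>\<bar>v\<bar> powr e\<close> covers e <= 0 and
  \<open>1 + \<bar>v\<bar>\<close> covers 0 < e <= 1.\<close>

lemma integral_vertical_kernel_base:
  fixes z :: complex
  assumes al: "1 < \<alpha>" "\<alpha> \<le> 2" and m: "m > 0" and z: "- 2 \<le> Re z" "Re z < 0"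
  shows "(LINT v|lborel. vertical_kernel \<alpha> m z v) = 2 * pi * exp (z / \<alpha> * complex_of_real (ln m)) * rGamma (1 + z / \<alpha>) / \<alpha>"
proof -
  obtain A where A: "A > 0" "\<And>p v. 0 < p \<Longrightarrow> p \<le> 1 \<Longrightarrow> v \<noteq> 0 \<Longrightarrow>
     norm (exp (complex_of_real m * Complex p v powr complex_of_real \<alpha>)) \<le> A * exp (- m * \<bar>v\<bar>)"
    using exp_powr_strip_bound[OF al m] by blast
  define D where "D = exp (pi * \<bar>Im z\<bar>)"
  define e where "e = - 1 - Re z"
  have e: "- 1 < e" "e \<le> 1" using z by (auto simp: e_def)
  show ?thesis
    unfolding integral_imaginary_axis[OF al m z(2), symmetric] vertical_kernel_def
  proof (rule integral_vertical_halfplane_eq_limit(2)[where W = "\<lambda>v. D * A * ((v powr e + 1 + v) * exp (- m * v))"])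
    show "(\<lambda>\<zeta>. \<zeta> powr (- 1 - z) * exp (complex_of_real m * \<zeta> powr complex_of_real \<alpha>)) holomorphic_on {z. Re z > 0}"
      by (intro holomorphic_intros holomorphic_on_powr_halfplane)
    have "integrable lborel (\<lambda>v. \<bar>v\<bar> powr e * exp (- m * \<bar>v\<bar>) + (1 + \<bar>v\<bar>) * exp (- m * \<bar>v\<bar>))"
      by (intro Bochner_Integration.integrable_add integrable_linear_exp_abs integrable_abs_powr_exp m e)
    then show "integrable lborel (\<lambda>v. D * A * ((\<bar>v\<bar> powr e + 1 + \<bar>v\<bar>) * exp (- m * \<bar>v\<bar>)))"
      by (simp add: distrib_right add.assoc)
    show "((\<lambda>v. D * A * ((v powr e + 1 + v) * exp (- m * v))) \<longlongrightarrow> 0) at_top"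
      using m by real_asymp
    fix p v :: real assume pv: "0 < p" "p \<le> 1" "v \<noteq> 0"
    have nz: "Complex p v \<noteq> 0" using pv by (simp add: complex_eq_iff)
    have nv: "\<bar>v\<bar> \<le> norm (Complex p v)" "norm (Complex p v) \<le> 1 + \<bar>v\<bar>"
      using abs_Im_le_cmod[of "Complex p v"] cmod_le[of "Complex p v"] pv by auto
    have "norm (Complex p v) powr e \<le> \<bar>v\<bar> powr e + 1 + \<bar>v\<bar>"
    proof (cases "e \<le> 0")
      case True
      have "norm (Complex p v) powr e \<le> \<bar>v\<bar> powr e"
        using nv pv True by (intro powr_mono2') auto
      then show ?thesis by simp
    next
      case False
      have "norm (Complex p v) powr e \<le> (1 + \<bar>v\<bar>) powr e" using nv False by (intro powr_mono2) auto
      also have "\<dots> \<le> (1 + \<bar>v\<bar>) powr 1" using e by (intro powr_mono) auto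
      finally show ?thesis by (simp add: add.assoc add_increasing)
    qed
    then have "norm (Complex p v powr (- 1 - z)) \<le> (\<bar>v\<bar> powr e + 1 + \<bar>v\<bar>) * D"
      using norm_powr_complex_le[OF nz, of "- 1 - z"]
      by (simp add: D_def e_def) (meson exp_ge_zero mult_right_mono order_trans)
    then have "norm (Complex p v powr (- 1 - z)) * norm (exp (complex_of_real m * Complex p v powr complex_of_real \<alpha>)) \<le> ((\<bar>v\<bar> powr e + 1 + \<bar>v\<bar>) * D) * (A * exp (- m * \<bar>v\<bar>))"
      using A(2)[OF pv] by (intro mult_mono) (auto simp: D_def)
    then show "norm (Complex p v powr (- 1 - z) * exp (complex_of_real m * Complex p v powr complex_of_real \<alpha>)) \<le> D * A * ((\<bar>v\<bar> powr e + 1 + \<bar>v\<bar>) * exp (- m * \<bar>v\<bar>))"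
      by (simp add: norm_mult mult_ac)
  next
    fix v :: real assume v: "v \<noteq> 0"
    show "((\<lambda>p. Complex p v powr (- 1 - z) * exp (complex_of_real m * Complex p v powr complex_of_real \<alpha>)) \<longlongrightarrow>
       exp ((- 1 - z) * (complex_of_real (ln \<bar>v\<bar>) + \<i> * complex_of_real (sgn v * pi / 2)))
      * exp (complex_of_real m * exp (complex_of_real \<alpha> * (complex_of_real (ln \<bar>v\<bar>) + \<i> * complex_of_real (sgn v * pi / 2))))) (at_right 0)"
      unfolding powr_ii_axis[OF v, symmetric]
      by (intro tendsto_mult tendsto_exp tendsto_const tendsto_powr_axis v)
  qed measurable
qed

text \<open>The function \<open>\<zeta> powr (- z) * exp (m * \<zeta> powr \<alpha>)\<close>
  vanishes at both ends of the line, so its derivative integrates to 0. For \<open>Re z >= 0\<close>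
  the power is bounded there because \<open>norm \<zeta> >= 1\<close>.\<close>

lemma integral_vertical_kernel_step:
  fixes z :: complex
  assumes al: "1 < \<alpha>" "\<alpha> \<le> 2" and m: "m > 0" and z: "0 \<le> Re z"
  shows "z * (LINT v|lborel. vertical_kernel \<alpha> m z v) = m * \<alpha> * (LINT v|lborel. vertical_kernel \<alpha> m (z - \<alpha>) v)"
proof -
  obtain A where A: "A > 0" "\<And>p v. 0 < p \<Longrightarrow> p \<le> 1 \<Longrightarrow> v \<noteq> 0 \<Longrightarrow>
     norm (exp (complex_of_real m * Complex p v powr complex_of_real \<alpha>)) \<le> A * exp (- m * \<bar>v\<bar>)"
    using exp_powr_strip_bound[OF al m] by blast
  define D where "D = exp (pi * \<bar>Im z\<bar>)"
  define g where "g = (\<lambda>v. Complex 1 v powr (- z) * exp (complex_of_real m * Complex 1 v powr complex_of_real \<alpha>))"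
  define g' where "g' = (\<lambda>v. \<i> * (- z * vertical_kernel \<alpha> m z v + m * \<alpha> * vertical_kernel \<alpha> m (z - \<alpha>) v))"
  have deriv: "(g has_vector_derivative g' v) (at v)" for v
  proof -
    define \<zeta> where "\<zeta> = Complex 1 v"
    have nz: "\<zeta> \<notin> \<real>\<^sub>\<le>\<^sub>0" "\<zeta> \<noteq> 0" by (auto simp: \<zeta>_def complex_nonpos_Reals_iff complex_eq_iff)
    have 1: "((\<lambda>\<zeta>. \<zeta> powr (- z) * exp (complex_of_real m * \<zeta> powr complex_of_real \<alpha>)) has_field_derivative
       (- z * \<zeta> powr (- z - 1)) * exp (complex_of_real m * \<zeta> powr complex_of_real \<alpha>)
       + (exp (complex_of_real m * \<zeta> powr complex_of_real \<alpha>) * (complex_of_real m * (complex_of_real \<alpha> * \<zeta> powr (complex_of_real \<alpha> - 1)))) * \<zeta> powr (- z)) (at \<zeta>)"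
      by (intro DERIV_mult DERIV_fun_exp DERIV_cmult has_field_derivative_powr nz)
    have 2: "((\<lambda>v. Complex 1 v) has_vector_derivative \<i>) (at v)"
      unfolding Complex_eq by (auto intro!: derivative_eq_intros)
    have "\<zeta> powr (complex_of_real \<alpha> - 1) * \<zeta> powr (- z) = \<zeta> powr (- 1 - (z - complex_of_real \<alpha>))"
      using nz by (simp add: powr_def mult_exp_exp algebra_simps)
    then have p2: "\<zeta> powr (- 1 - (z - complex_of_real \<alpha>)) = \<zeta> powr (complex_of_real \<alpha> - 1) * \<zeta> powr (- z)" ..
    have p1: "- 1 - z = - z - 1" by simp
    have eq: "\<i> * ((- z * \<zeta> powr (- z - 1)) * exp (complex_of_real m * \<zeta> powr complex_of_real \<alpha>)
       + (exp (complex_of_real m * \<zeta> powr complex_of_real \<alpha>) * (complex_of_real m * (complex_of_real \<alpha> * \<zeta> powr (complex_of_real \<alpha> - 1)))) * \<zeta> powr (- z)) = g' v"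
      unfolding g'_def vertical_kernel_def \<zeta>_def[symmetric] p2 p1 by (simp add: mult_ac)
    show ?thesis
      using field_vector_diff_chain_at[OF 2 1[unfolded \<zeta>_def]] eq unfolding \<zeta>_def g_def o_def by simp
  qed
  have kint: "integrable lborel (vertical_kernel \<alpha> m z)" "integrable lborel (vertical_kernel \<alpha> m (z - \<alpha>))"
    using z al by (auto intro!: integrable_vertical_kernel m)
  have gb: "norm (g v) \<le> D * A * exp (- m * \<bar>v\<bar>)" if v: "v \<noteq> 0" for v
  proof -
    have n1: "1 \<le> norm (Complex 1 v)" using abs_Re_le_cmod[of "Complex 1 v"] by simp
    have "norm (Complex 1 v powr (- z)) \<le> norm (Complex 1 v) powr (- Re z) * D"
      using norm_powr_complex_le[of "Complex 1 v" "- z"] by (simp add: D_def complex_eq_iff)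
    also have "norm (Complex 1 v) powr (- Re z) \<le> norm (Complex 1 v) powr 0"
      using n1 z by (intro powr_mono) auto
    also have "\<dots> = 1" by (simp add: complex_eq_iff)
    finally have "norm (Complex 1 v powr (- z)) \<le> D" by (simp add: D_def)
    then show ?thesis
      unfolding g_def norm_mult mult.assoc using A v by (intro mult_mono) (auto simp: D_def)
  qed
  have "(LBINT v=-\<infinity>..\<infinity>. g' v) = 0 - 0"
  proof (rule interval_integral_FTC_integrable)
    show "isCont g' v" for v
      using continuous_vertical_kernel unfolding g'_def
      by (intro continuous_intros) (auto simp: continuous_on_eq_continuous_at)
    show "set_integrable lborel (einterval (- \<infinity>) \<infinity>) g'"
      using kint unfolding g'_def set_integrable_def by simp
    have "(g \<longlongrightarrow> 0) at_top"
    proof (rule Lim_null_comparison)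
      show "eventually (\<lambda>v. norm (g v) \<le> D * A * exp (- m * v)) at_top"
        using eventually_gt_at_top[of 0]
      proof eventually_elim
        case (elim v)
        then show ?case using gb[of v] by simp
      qed
      show "((\<lambda>v. D * A * exp (- m * v)) \<longlongrightarrow> 0) at_top" using m by real_asymp
    qed
    then show "((g \<circ> real_of_ereal) \<longlongrightarrow> 0) (at_left \<infinity>)" by (simp add: ereal_tendsto_simps)
    have "(g \<longlongrightarrow> 0) at_bot"
    proof (rule Lim_null_comparison)
      show "eventually (\<lambda>v. norm (g v) \<le> D * A * exp (m * v)) at_bot"
        using eventually_gt_at_bot[of 0]
      proof eventually_elim
        case (elim v)
        then show ?case using gb[of v] by simp
      qed
      show "((\<lambda>v. D * A * exp (m * v)) \<longlongrightarrow> 0) at_bot" using m by real_asymp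
    qed
    then show "((g \<circ> real_of_ereal) \<longlongrightarrow> 0) (at_right (- \<infinity>))" by (simp add: ereal_tendsto_simps)
  qed (use deriv in auto)
  then have "(LINT v|lborel. g' v) = 0"
    by (simp add: interval_lebesgue_integral_def set_lebesgue_integral_def)
  moreover have "(LINT v|lborel. g' v) = \<i> * (- z * (LINT v|lborel. vertical_kernel \<alpha> m z v) + m * \<alpha> * (LINT v|lborel. vertical_kernel \<alpha> m (z - \<alpha>) v))"
    unfolding g'_def using kint by simp
  ultimately show ?thesis by simp
qed

text \<open>The closed form satisfies the same recurrence: the shift by \<alpha> costs a factor 1 /
  m in the exponential and z / \<alpha> in the reciprocal Gamma value. Since the recurrence
  determines the integral only after division by z, the real axis is excluded; on a vertical line
  this loses a single point.\<close>

lemma integral_vertical_kernel: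
  fixes z :: complex
  assumes al: "1 < \<alpha>" "\<alpha> \<le> 2" and m: "m > 0" and z: "- 2 \<le> Re z" "Im z \<noteq> 0"
  shows "(LINT v|lborel. vertical_kernel \<alpha> m z v) = 2 * pi * exp (z / \<alpha> * complex_of_real (ln m)) * rGamma (1 + z / \<alpha>) / \<alpha>"
proof -
  have "- 2 \<le> Re z \<Longrightarrow> Im z \<noteq> 0 \<Longrightarrow> Re z < real n * \<alpha> \<Longrightarrow>
    (LINT v|lborel. vertical_kernel \<alpha> m z v) = 2 * pi * exp (z / \<alpha> * complex_of_real (ln m)) * rGamma (1 + z / \<alpha>) / \<alpha>" for n and z :: complex
  proof (induction n arbitrary: z)
    case (0 z)
    then show ?case using integral_vertical_kernel_base[OF al m] by simp
  next
    case (Suc n z)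
    show ?case
    proof (cases "Re z < 0")
      case True
      then show ?thesis using integral_vertical_kernel_base[OF al m] Suc.prems by simp
    next
      case False
      have nz: "z \<noteq> 0" using Suc.prems by auto
      have IH: "(LINT v|lborel. vertical_kernel \<alpha> m (z - \<alpha>) v) = 2 * pi * exp ((z - \<alpha>) / \<alpha> * complex_of_real (ln m)) * rGamma (1 + (z - \<alpha>) / \<alpha>) / \<alpha>"
        using Suc.prems False al by (intro Suc.IH) (auto simp: algebra_simps)
      have a0: "complex_of_real \<alpha> \<noteq> 0" using al by simp
      have "(z - \<alpha>) / \<alpha> * complex_of_real (ln m) = z / \<alpha> * complex_of_real (ln m) - complex_of_real (ln m)"
        using a0 by (simp add: field_simps)
      then have e: "exp ((z - \<alpha>) / \<alpha> * complex_of_real (ln m)) = exp (z / \<alpha> * complex_of_real (ln m)) / m"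
        using m by (simp add: exp_diff exp_of_real)
      have "1 + (z - \<alpha>) / \<alpha> = z / \<alpha>" using a0 by (simp add: field_simps)
      then have r: "rGamma (1 + (z - \<alpha>) / \<alpha>) = z / \<alpha> * rGamma (1 + z / \<alpha>)"
        using rGamma_plus1[of "z / \<alpha>"] by (simp add: add.commute)
      have "z * (LINT v|lborel. vertical_kernel \<alpha> m z v) = z * (2 * pi * exp (z / \<alpha> * complex_of_real (ln m)) * rGamma (1 + z / \<alpha>) / \<alpha>)"
        using False integral_vertical_kernel_step[OF al m, of z] m a0 unfolding IH e r by simp
      then show ?thesis using nz mult_left_cancel by blast
    qed
  qed
  moreover obtain n where "Re z < real n * \<alpha>"
    using al reals_Archimedean3[of \<alpha>] by (metis order_less_trans zero_less_one)
  ultimately show ?thesis using z by blast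
qed

section \<open>Mellin representation of the stable density\<close>

text \<open>The strip bound survives the limit p to 0. On the axis itself it gives integrability of
  the characteristic function.\<close>

lemma norm_exp_axis_le:
  assumes al: "1 < \<alpha>" "\<alpha> \<le> 2" and m: "m > 0"
  shows "\<exists>A. \<forall>k. k \<noteq> 0 \<longrightarrow> norm (exp (complex_of_real m * Complex 0 k powr complex_of_real \<alpha>)) \<le> A * exp (- m * \<bar>k\<bar>)"
proof -
  obtain A where A: "\<And>p v. 0 < p \<Longrightarrow> p \<le> 1 \<Longrightarrow> v \<noteq> 0 \<Longrightarrow>
     norm (exp (complex_of_real m * Complex p v powr complex_of_real \<alpha>)) \<le> A * exp (- m * \<bar>v\<bar>)"
    using exp_powr_strip_bound[OF al m] by blast
  have "norm (exp (complex_of_real m * Complex 0 k powr complex_of_real \<alpha>)) \<le> A * exp (- m * \<bar>k\<bar>)" if k: "k \<noteq> 0" for k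
  proof (rule tendsto_upperbound)
    show "((\<lambda>p. norm (exp (complex_of_real m * Complex p k powr complex_of_real \<alpha>))) \<longlongrightarrow> norm (exp (complex_of_real m * Complex 0 k powr complex_of_real \<alpha>))) (at_right 0)"
      by (intro tendsto_norm tendsto_mult tendsto_exp tendsto_const tendsto_powr_axis k)
    have "eventually (\<lambda>p::real. p \<in> {0<..<1}) (at_right 0)"
      by (rule eventually_at_right_real) simp
    then show "\<forall>\<^sub>F p in at_right 0. norm (exp (complex_of_real m * Complex p k powr complex_of_real \<alpha>)) \<le> A * exp (- m * \<bar>k\<bar>)"
      by eventually_elim (use A k in auto)
  qed simp
  then show ?thesis by blast
qed

lemma measurable_Complex [measurable (raw)]:
  "f \<in> borel_measurable M \<Longrightarrow> g \<in> borel_measurable M \<Longrightarrow> (\<lambda>x. Complex (f x) (g x)) \<in> borel_measurable M"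
  by (simp add: borel_measurable_complex_iff)

definition line_exp :: "real \<Rightarrow> real \<Rightarrow> real \<Rightarrow> complex" where
  "line_exp \<alpha> m v = exp (complex_of_real m * Complex 1 v powr complex_of_real \<alpha>)"

text \<open>\<open>2 \<pi>\<close> times the density of the law on \<open>{0<..}\<close>\<close>

definition bromwich :: "real \<Rightarrow> real \<Rightarrow> real \<Rightarrow> complex" where
  "bromwich \<alpha> m x = (LINT v|lborel. line_exp \<alpha> m v * exp (- (Complex 1 v * complex_of_real x)))"

lemma line_exp_kernel: "line_exp \<alpha> m = vertical_kernel \<alpha> m (- 1)"
  by (simp add: line_exp_def vertical_kernel_def fun_eq_iff complex_eq_iff)

lemma exp_Complex_1: "exp (- (Complex 1 v * complex_of_real x)) = complex_of_real (exp (- x)) * iexp (- (v * x))"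
  by (simp add: Complex_eq exp_of_real[symmetric] mult_exp_exp algebra_simps)

text \<open>For m = - \<mu> \<tau> this is the factor of the pricing integrand that accompanies
  \<open>K_star\<close>. It turns out to be the Mellin transform at 1 - s of the density restricted
  to the positive half-line.\<close>

definition mellin_weight :: "real \<Rightarrow> real \<Rightarrow> complex \<Rightarrow> complex" where
  "mellin_weight \<alpha> m s = G_star \<alpha> s * exp (- s / complex_of_real \<alpha> * complex_of_real (ln m))"

context
  fixes \<alpha> m :: real
  assumes al: "1 < \<alpha>" "\<alpha> \<le> 2" and m: "m > 0"
begin

lemma integrable_line_exp: "integrable lborel (line_exp \<alpha> m)"
  unfolding line_exp_kernel by (rule integrable_vertical_kernel[OF al m]) simp

lemma measurable_line_exp [measurable]: "line_exp \<alpha> m \<in> borel_measurable borel"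
  using integrable_line_exp by auto

lemma bromwich_eq: "bromwich \<alpha> m x = complex_of_real (exp (- x)) * (LINT v|lborel. line_exp \<alpha> m v * iexp (- (v * x)))"
  unfolding bromwich_def exp_Complex_1
  by (subst integral_mult_right_zero[symmetric]) (intro Bochner_Integration.integral_cong refl, simp)

lemma isCont_bromwich: "isCont (bromwich \<alpha> m) x"
proof -
  have "isCont (\<lambda>x. LINT v|lborel. line_exp \<alpha> m v * iexp (- (v * x))) x"
    unfolding continuous_at_sequentially o_def
  proof (intro allI impI)
    fix X assume X: "X \<longlonglongrightarrow> x"
    show "(\<lambda>n. LINT v|lborel. line_exp \<alpha> m v * iexp (- (v * X n))) \<longlonglongrightarrow> (LINT v|lborel. line_exp \<alpha> m v * iexp (- (v * x)))"
    proof (rule integral_dominated_convergence)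
      show "integrable lborel (\<lambda>v. norm (line_exp \<alpha> m v))" using integrable_line_exp by auto
      show "AE v in lborel. (\<lambda>n. line_exp \<alpha> m v * iexp (- (v * X n))) \<longlonglongrightarrow> line_exp \<alpha> m v * iexp (- (v * x))"
        by (intro AE_I2 tendsto_intros X)
    qed (auto simp: norm_mult)
  qed
  then show ?thesis
    unfolding bromwich_eq[abs_def] by (intro continuous_intros)
qed

text \<open>The decay in x is the modulus of \<open>exp (- \<zeta> x)\<close> on
  \<open>Re \<zeta> = 1\<close>.\<close>

lemma norm_bromwich_le: "norm (bromwich \<alpha> m x) \<le> exp (- x) * (LINT v|lborel. norm (line_exp \<alpha> m v))"
proof -
  have "norm (LINT v|lborel. line_exp \<alpha> m v * iexp (- (v * x))) \<le> (LINT v|lborel. norm (line_exp \<alpha> m v * iexp (- (v * x))))"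
    by (rule integral_norm_bound)
  then show ?thesis unfolding bromwich_eq by (simp add: norm_mult)
qed

lemma measurable_bromwich [measurable]: "bromwich \<alpha> m \<in> borel_measurable borel"
  using isCont_bromwich by (intro borel_measurable_continuous_onI continuous_at_imp_continuous_on) auto

text \<open>Since \<open>exp (- \<zeta> x)\<close> has modulus \<open>exp (- x)\<close> on the whole
  line, the double integrand is dominated by a product of a Gamma integrand in x and
  \<open>line_exp\<close> in v. After the exchange, the integral in x is Euler's integral with the
  complex parameter 1 + \<i> v.\<close>

lemma mellin_bromwich_aux:
  assumes z: "- 1 < Re z"
  shows "integrable lborel (\<lambda>x. indicator {0<..} x *\<^sub>R (exp (z * complex_of_real (ln x)) * bromwich \<alpha> m x))"
    and "(LINT x|lborel. indicator {0<..} x *\<^sub>R (exp (z * complex_of_real (ln x)) * bromwich \<alpha> m x))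
       = Gamma (1 + z) * (LINT v|lborel. vertical_kernel \<alpha> m z v)"
proof -
  define p where "p = (\<lambda>x. indicator {0<..} x *\<^sub>R (exp (z * complex_of_real (ln x)) * exp (- complex_of_real x)))"
  define k where "k = (\<lambda>x v. indicator {0<..} x *\<^sub>R (exp (z * complex_of_real (ln x)) * (line_exp \<alpha> m v * exp (- (Complex 1 v * complex_of_real x)))))"
  have pint: "integrable lborel p"
    using Gamma_integral_exp[of "1 + z"] z unfolding p_def by (simp add: has_bochner_integral_iff)
  have kmeas: "(\<lambda>(x, v). k x v) \<in> borel_measurable (lborel \<Otimes>\<^sub>M lborel)"
    unfolding k_def by measurable
  have kint: "integrable (lborel \<Otimes>\<^sub>M lborel) (\<lambda>(x, v). k x v)"
    by (rule Bochner_Integration.integrable_bound[OF integrable_product_lborel[OF pint integrable_line_exp] kmeas])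
      (auto simp: k_def p_def norm_mult exp_Complex_1)
  have inner: "(LINT v|lborel. k x v) = indicator {0<..} x *\<^sub>R (exp (z * complex_of_real (ln x)) * bromwich \<alpha> m x)" for x
    unfolding k_def bromwich_def by simp
  show "integrable lborel (\<lambda>x. indicator {0<..} x *\<^sub>R (exp (z * complex_of_real (ln x)) * bromwich \<alpha> m x))"
    using lborel_pair.integrable_fst'[OF kint] by (simp add: inner)
  have "(LINT x|lborel. indicator {0<..} x *\<^sub>R (exp (z * complex_of_real (ln x)) * bromwich \<alpha> m x)) = (LINT x|lborel. LINT v|lborel. k x v)"
    by (simp add: inner)
  also have "\<dots> = (LINT v|lborel. LINT x|lborel. k x v)"
    by (rule lborel_pair.Fubini_integral[symmetric]) (use kint in simp)
  also have "\<dots> = (LINT v|lborel. Gamma (1 + z) * vertical_kernel \<alpha> m z v)"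
  proof (intro Bochner_Integration.integral_cong refl)
    fix v
    have "has_bochner_integral lborel
       (\<lambda>x. indicator {0<..} x *\<^sub>R (exp ((1 + z - 1) * complex_of_real (ln x)) * exp (- (Complex 1 v * complex_of_real x))))
       (Gamma (1 + z) * Complex 1 v powr (- (1 + z)))"
      by (rule Gamma_integral_halfplane) (use z in auto)
    then have "has_bochner_integral lborel
       (\<lambda>x. line_exp \<alpha> m v * (indicator {0<..} x *\<^sub>R (exp ((1 + z - 1) * complex_of_real (ln x)) * exp (- (Complex 1 v * complex_of_real x)))))
       (line_exp \<alpha> m v * (Gamma (1 + z) * Complex 1 v powr (- (1 + z))))"
      by (rule has_bochner_integral_mult_right)
    also have "(\<lambda>x. line_exp \<alpha> m v * (indicator {0<..} x *\<^sub>R (exp ((1 + z - 1) * complex_of_real (ln x)) * exp (- (Complex 1 v * complex_of_real x))))) = (\<lambda>x. k x v)"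
      by (simp add: k_def mult_ac)
    also have "line_exp \<alpha> m v * (Gamma (1 + z) * Complex 1 v powr (- (1 + z))) = Gamma (1 + z) * vertical_kernel \<alpha> m z v"
      by (simp add: line_exp_def vertical_kernel_def mult_ac)
    finally show "(LINT x|lborel. k x v) = Gamma (1 + z) * vertical_kernel \<alpha> m z v"
      by (rule has_bochner_integral_integral_eq)
  qed
  finally show "(LINT x|lborel. indicator {0<..} x *\<^sub>R (exp (z * complex_of_real (ln x)) * bromwich \<alpha> m x))
       = Gamma (1 + z) * (LINT v|lborel. vertical_kernel \<alpha> m z v)"
    by simp
qed

lemma mellin_bromwich:
  assumes s: "Re s < 1" "Im s \<noteq> 0"
  shows "(LINT x|lborel. indicator {0<..} x *\<^sub>R (exp (- s * complex_of_real (ln x)) * bromwich \<alpha> m x)) = 2 * pi * mellin_weight \<alpha> m s"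
proof -
  have "(LINT x|lborel. indicator {0<..} x *\<^sub>R (exp (- s * complex_of_real (ln x)) * bromwich \<alpha> m x))
      = Gamma (1 + (- s)) * (LINT v|lborel. vertical_kernel \<alpha> m (- s) v)"
    by (rule mellin_bromwich_aux(2)) (use s in simp)
  also have "(LINT v|lborel. vertical_kernel \<alpha> m (- s) v) = 2 * pi * exp (- s / \<alpha> * complex_of_real (ln m)) * rGamma (1 + (- s) / \<alpha>) / \<alpha>"
    by (rule integral_vertical_kernel[OF al m]) (use s in auto)
  finally show ?thesis
    by (simp add: mellin_weight_def G_star_eq_rGamma)
qed

lemma integrable_mellin_weight:
  assumes "c < 1"
  shows "integrable lborel (\<lambda>u. mellin_weight \<alpha> m (Complex c u))"
proof (rule Bochner_Integration.integrable_bound)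
  show "integrable lborel (\<lambda>u. complex_of_real (exp (- c / \<alpha> * ln m)) * G_star \<alpha> (Complex c u))"
    using G_star_vertical_integrable[OF al(1) assms] by simp
  have [measurable]: "(\<lambda>u. G_star \<alpha> (Complex c u)) \<in> borel_measurable borel"
    using G_star_vertical_integrable[OF al(1) assms] by auto
  show "(\<lambda>u. mellin_weight \<alpha> m (Complex c u)) \<in> borel_measurable lborel"
    unfolding mellin_weight_def by measurable
qed (auto simp: mellin_weight_def norm_mult)

text \<open>With x = exp y the Mellin transform along \<open>Re s = c\<close> becomes the Fourier
  transform of the bounded continuous function
  \<open>exp (b * y) * bromwich \<alpha> m (exp y)\<close>, where b = 1 - c. It is known to be the
  weight except at u = 0, a null set; the integrability of the weight, due to the decay of
  \<open>G_star\<close>, then permits Fourier inversion.\<close>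

lemma bromwich_mellin_inversion:
  assumes c: "c < 1" and x: "x > 0"
  shows "(LINT u|lborel. mellin_weight \<alpha> m (Complex c u) * exp ((Complex c u - 1) * complex_of_real (ln x))) = bromwich \<alpha> m x"
proof -
  define b where "b = 1 - c"
  have b: "b > 0" using c by (simp add: b_def)
  define f where "f = (\<lambda>y. exp (complex_of_real (b * y)) * bromwich \<alpha> m (exp y))"
  have fm[measurable]: "f \<in> borel_measurable borel" unfolding f_def by measurable
  have f_int: "integrable lborel f"
  proof -
    have "has_bochner_integral lborel (\<lambda>x. indicator {0<..} x *\<^sub>R (exp (complex_of_real (- c) * complex_of_real (ln x)) * bromwich \<alpha> m x))
      (LINT x|lborel. indicator {0<..} x *\<^sub>R (exp (complex_of_real (- c) * complex_of_real (ln x)) * bromwich \<alpha> m x))"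
      by (intro has_bochner_integral_integrable mellin_bromwich_aux) (use c in simp)
    then have "integrable lborel (\<lambda>y. exp y *\<^sub>R (exp (complex_of_real (- c) * complex_of_real (ln (exp y))) * bromwich \<alpha> m (exp y)))"
      by (subst (asm) has_bochner_integral_exp_substitution) (auto simp: has_bochner_integral_iff)
    also have "(\<lambda>y. exp y *\<^sub>R (exp (complex_of_real (- c) * complex_of_real (ln (exp y))) * bromwich \<alpha> m (exp y))) = f"
    proof
      fix y
      have "complex_of_real (exp y) * exp (complex_of_real (- c) * complex_of_real y) = exp (complex_of_real (b * y))"
        by (simp add: b_def exp_of_real[symmetric] mult_exp_exp algebra_simps)
      then show "exp y *\<^sub>R (exp (complex_of_real (- c) * complex_of_real (ln (exp y))) * bromwich \<alpha> m (exp y)) = f y"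
        unfolding f_def by (simp add: scaleR_conv_of_real flip: mult.assoc)
    qed
    finally show ?thesis .
  qed
  define N where "N = (LINT v|lborel. norm (line_exp \<alpha> m v))"
  have N: "N \<ge> 0" by (simp add: N_def)
  have f_bound: "norm (f y) \<le> exp (b * (ln b - 1)) * N" for y
  proof -
    \<comment> \<open>The maximum of \<open>b * y - exp y\<close> is attained at exp y = b; the
      inequality for the logarithm at exp y / b expresses this without calculus.\<close>
    have "ln (exp y / b) \<le> exp y / b - 1" by (rule ln_le_minus_one) (use b in simp)
    then have "b * (y - ln b) \<le> b * (exp y / b - 1)" using b by (intro mult_left_mono) (auto simp: ln_div)
    then have "b * y - exp y \<le> b * (ln b - 1)" using b by (simp add: algebra_simps)
    then have e: "exp (b * y - exp y) \<le> exp (b * (ln b - 1))" by simp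
    have "norm (f y) = exp (b * y) * norm (bromwich \<alpha> m (exp y))" by (simp add: f_def norm_mult)
    also have "\<dots> \<le> exp (b * y) * (exp (- exp y) * N)"
      using norm_bromwich_le[of "exp y"] by (intro mult_left_mono) (auto simp: N_def)
    also have "\<dots> = exp (b * y - exp y) * N" by (simp add: exp_diff exp_minus divide_inverse)
    also have "\<dots> \<le> exp (b * (ln b - 1)) * N" using e N by (rule mult_right_mono)
    finally show ?thesis .
  qed
  have f_cont: "isCont f y" for y
    unfolding f_def by (intro continuous_intros isCont_o2[OF _ isCont_bromwich])
  define Ft where "Ft = (\<lambda>u. CLINT y|lborel. f y * iexp (- (u * y)))"
  have Ft_meas[measurable]: "Ft \<in> borel_measurable borel" unfolding Ft_def by measurable
  have Ft_eq: "Ft u = 2 * pi * mellin_weight \<alpha> m (Complex c u)" if u: "u \<noteq> 0" for u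
  proof -
    define h where "h = (\<lambda>x. exp (- Complex c u * complex_of_real (ln x)) * bromwich \<alpha> m x)"
    have hm[measurable]: "h \<in> borel_measurable borel" unfolding h_def by measurable
    have "has_bochner_integral lborel (\<lambda>x. indicator {0<..} x *\<^sub>R h x) (2 * pi * mellin_weight \<alpha> m (Complex c u))"
      unfolding has_bochner_integral_iff h_def
      using mellin_bromwich[of "Complex c u"] mellin_bromwich_aux(1)[of "- Complex c u"] c u by simp
    then have "has_bochner_integral lborel (\<lambda>y. exp y *\<^sub>R h (exp y)) (2 * pi * mellin_weight \<alpha> m (Complex c u))"
      by (subst (asm) has_bochner_integral_exp_substitution) measurable
    also have "(\<lambda>y. exp y *\<^sub>R h (exp y)) = (\<lambda>y. f y * iexp (- (u * y)))"
    proof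
      fix y
      have "complex_of_real (exp y) * exp (- Complex c u * complex_of_real y) = exp (complex_of_real (b * y)) * iexp (- (u * y))"
        by (simp add: Complex_eq b_def exp_of_real[symmetric] mult_exp_exp algebra_simps)
      then show "exp y *\<^sub>R h (exp y) = f y * iexp (- (u * y))"
        unfolding h_def f_def by (simp add: scaleR_conv_of_real mult_ac)
    qed
    finally show ?thesis unfolding Ft_def by (rule has_bochner_integral_integral_eq)
  qed
  have AE0: "AE u in lborel. u \<noteq> (0::real)" by (rule AE_lborel_singleton)
  have wm[measurable]: "(\<lambda>u. mellin_weight \<alpha> m (Complex c u)) \<in> borel_measurable borel"
    using integrable_mellin_weight[OF c] by auto
  have AE: "AE u in lborel. Ft u = 2 * pi * mellin_weight \<alpha> m (Complex c u)"
    using AE0 by eventually_elim (rule Ft_eq)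
  have "integrable lborel (\<lambda>u. 2 * pi * mellin_weight \<alpha> m (Complex c u))"
    using integrable_mellin_weight[OF c] by simp
  then have Ft_int: "integrable lborel Ft"
    by (subst integrable_cong_AE[OF _ _ AE]) auto
  have "(CLINT u|lborel. Ft u * iexp (u * ln x)) = 2 * pi * f (ln x)"
    unfolding Ft_def by (rule fourier_inversion[OF f_int f_bound f_cont]) (use Ft_int in \<open>simp add: Ft_def\<close>)
  moreover have "(CLINT u|lborel. Ft u * iexp (u * ln x)) = (CLINT u|lborel. (2 * pi) * (mellin_weight \<alpha> m (Complex c u) * iexp (u * ln x)))"
    by (rule integral_cong_AE) (use AE in \<open>auto elim!: eventually_mono\<close>)
  ultimately have "(CLINT u|lborel. mellin_weight \<alpha> m (Complex c u) * iexp (u * ln x)) = f (ln x)"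
    by simp
  then have "exp (- complex_of_real (b * ln x)) * (CLINT u|lborel. mellin_weight \<alpha> m (Complex c u) * iexp (u * ln x)) = bromwich \<alpha> m x"
    using x by (simp add: f_def exp_minus)
  also have "exp (- complex_of_real (b * ln x)) * (CLINT u|lborel. mellin_weight \<alpha> m (Complex c u) * iexp (u * ln x)) = 
     (CLINT u|lborel. exp (- complex_of_real (b * ln x)) * (mellin_weight \<alpha> m (Complex c u) * iexp (u * ln x)))"
    by (rule integral_mult_right_zero[symmetric])
  also have "\<dots> = (LINT u|lborel. mellin_weight \<alpha> m (Complex c u) * exp ((Complex c u - 1) * complex_of_real (ln x)))"
  proof (intro Bochner_Integration.integral_cong refl)
    fix u
    have "exp (- complex_of_real (b * ln x)) * iexp (u * ln x) = exp ((Complex c u - 1) * complex_of_real (ln x))"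
      by (simp add: Complex_eq b_def mult_exp_exp algebra_simps)
    then show "exp (- complex_of_real (b * ln x)) * (mellin_weight \<alpha> m (Complex c u) * iexp (u * ln x)) = mellin_weight \<alpha> m (Complex c u) * exp ((Complex c u - 1) * complex_of_real (ln x))"
      by (metis mult.left_commute)
  qed
  finally show ?thesis .
qed

end

section \<open>Option values\<close>

text \<open>For \<theta> = \<alpha> pi / 2 the power of \<i> k is \<open>\<bar>k\<bar> powr \<alpha>
  * cos \<theta> * (1 + \<i> * tan \<theta> * sgn k)\<close>, and the cosine in the denominator of
  \<mu> cancels \<open>cos \<theta>\<close>.\<close>

lemma stable_char_exponent:
  fixes \<sigma> \<alpha> \<tau> \<mu> k :: real
  assumes al: "1 < \<alpha>" "\<alpha> \<le> 2" and mu: "\<mu> = \<sigma> powr \<alpha> / cos (pi * \<alpha> / 2)" and k: "k \<noteq> 0"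
  shows "- complex_of_real (\<tau> * \<sigma> powr \<alpha> * \<bar>k\<bar> powr \<alpha>) * (1 + \<i> * complex_of_real (tan (\<alpha> * pi / 2) * sgn k))
    = complex_of_real (- \<mu> * \<tau>) * Complex 0 k powr complex_of_real \<alpha>"
proof -
  define \<theta> where "\<theta> = \<alpha> * pi / 2"
  have c: "cos \<theta> \<noteq> 0" using cos_half_pi_neg[OF al] by (simp add: \<theta>_def)
  have mu': "\<mu> = \<sigma> powr \<alpha> / cos \<theta>" using mu by (simp add: \<theta>_def mult.commute)
  have sg: "cos (sgn k * \<theta>) = cos \<theta>" "sin (sgn k * \<theta>) = sgn k * sin \<theta>"
    using k by (cases "k > 0"; simp)+
  have "Complex 0 k powr complex_of_real \<alpha> = exp (complex_of_real (\<alpha> * ln \<bar>k\<bar>) + \<i> * complex_of_real (sgn k * \<theta>))"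
    unfolding powr_ii_axis[OF k] by (rule arg_cong[of _ _ exp]) (simp add: \<theta>_def algebra_simps)
  also have "\<dots> = complex_of_real (\<bar>k\<bar> powr \<alpha>) * cis (sgn k * \<theta>)"
    using k by (simp add: exp_add cis_conv_exp powr_def flip: exp_of_real)
  also have "cis (sgn k * \<theta>) = complex_of_real (cos \<theta>) * (1 + \<i> * complex_of_real (tan \<theta> * sgn k))"
    using c by (simp add: complex_eq_iff sg tan_def)
  finally show ?thesis
    using c by (simp add: mu' \<theta>_def[symmetric])
qed

section \<open>Parseval formula for the Mellin transform, and conditioning\<close>

lemma measurable_powr_real [measurable]:
  "(\<lambda>x. complex_of_real x powr w) \<in> borel_measurable borel"
proof -
  have "complex_of_real x powr w = (if x = 0 then 0 else exp (w * (complex_of_real (ln \<bar>x\<bar>) + (if x < 0 then pi else 0) * \<i>)))" for x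
    by (simp add: powr_def Ln_of_real')
  then show ?thesis by simp
qed

lemma density_right_half_line:
  fixes M :: "real measure"
  assumes M: "real_distribution M" and al: "1 < \<alpha>" "\<alpha> \<le> 2" and m: "m > 0"
    and ch: "\<forall>k. k \<noteq> 0 \<longrightarrow> char M k = exp (complex_of_real m * Complex 0 k powr complex_of_real \<alpha>)"
  shows "\<exists>g. (\<forall>x. g x \<ge> 0) \<and> g \<in> borel_measurable borel \<and> M = density lborel g
    \<and> (\<forall>x\<ge>0. bromwich \<alpha> m x = complex_of_real (2 * pi * g x))"
proof -
  interpret real_distribution M by fact
  obtain A where A: "\<And>k. k \<noteq> 0 \<Longrightarrow> norm (exp (complex_of_real m * Complex 0 k powr complex_of_real \<alpha>)) \<le> A * exp (- m * \<bar>k\<bar>)"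
    using norm_exp_axis_le[OF al m] by blast
  have AE0: "AE k in lborel. k \<noteq> (0::real)" by (rule AE_lborel_singleton)
  have int: "integrable lborel (char M)"
  proof (rule Bochner_Integration.integrable_bound)
    show "integrable lborel (\<lambda>k. A * exp (- m * \<bar>k\<bar>))" using integrable_exp_abs[OF m] by simp
    show "AE k in lborel. norm (char M k) \<le> norm (A * exp (- m * \<bar>k\<bar>))"
      using AE0
    proof eventually_elim
      case (elim k)
      then show ?case using A[of k] ch by (metis abs_ge_self order_trans real_norm_def)
    qed
  qed simp
  obtain g where g: "\<And>x. g x \<ge> 0" "g \<in> borel_measurable borel" "M = density lborel g"
    and eq: "\<And>x. (CLINT k|lborel. char M k * iexp (- (k * x))) = complex_of_real (2 * pi * g x)"
    using density_from_char[OF M int] by blast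
  have "bromwich \<alpha> m x = complex_of_real (2 * pi * g x)" if x: "x \<ge> 0" for x
    using fourier_integral_eq_vertical[OF al m x char_measurable] ch eq[of x]
    by (simp add: bromwich_def line_exp_def)
  then show ?thesis using g by blast
qed

text \<open>For x > 0 the modulus of \<open>x powr (s - 1)\<close> depends on x and c only, so the
  joint integrand in (u, x) is dominated by the weight times the integrand at u = 0, and Fubini's
  theorem applies. Integrating over u first gives the density by Mellin inversion, integrating over
  x first gives the transform of \<open>h\<close>.\<close>

lemma mellin_parseval:
  fixes M :: "real measure" and h :: "real \<Rightarrow> real"
  assumes M: "real_distribution M" and al: "1 < \<alpha>" "\<alpha> \<le> 2" and m: "m > 0"
    and ch: "\<forall>k. k \<noteq> 0 \<longrightarrow> char M k = exp (complex_of_real m * Complex 0 k powr complex_of_real \<alpha>)"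
    and c: "c < 1" and h[measurable]: "h \<in> borel_measurable borel"
    and h0: "AE x in lborel. x < 0 \<longrightarrow> h x = 0"
    and h_int: "integrable lborel (\<lambda>x. complex_of_real (h x) * complex_of_real x powr (complex_of_real c - 1))"
  shows "integrable M h"
    and "integrable lborel (\<lambda>u. (LINT x|lborel. complex_of_real (h x) * complex_of_real x powr (Complex c u - 1)) * mellin_weight \<alpha> m (Complex c u))"
    and "(LINT u|lborel. (LINT x|lborel. complex_of_real (h x) * complex_of_real x powr (Complex c u - 1)) * mellin_weight \<alpha> m (Complex c u))
      = complex_of_real (2 * pi * (LINT x|M. h x))"
proof -
  obtain g where g: "\<And>x. g x \<ge> 0" "g \<in> borel_measurable borel" "M = density lborel g"
    and gb: "\<And>x. x \<ge> 0 \<Longrightarrow> bromwich \<alpha> m x = complex_of_real (2 * pi * g x)"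
    using density_right_half_line[OF M al m ch] by blast
  note g(2)[measurable]
  define w where "w = (\<lambda>u. mellin_weight \<alpha> m (Complex c u))"
  have w_int: "integrable lborel w"
    unfolding w_def by (rule integrable_mellin_weight[OF al m c])
  have wm[measurable]: "w \<in> borel_measurable borel" using w_int by auto
  have AE0: "AE x in lborel. x \<noteq> (0::real)" by (rule AE_lborel_singleton)
  define e where "e = (\<lambda>u x. indicator {0<..} x *\<^sub>R (complex_of_real (h x) * exp ((Complex c u - 1) * complex_of_real (ln x))))"
  have em[measurable]: "(\<lambda>(u, x). e u x) \<in> borel_measurable (lborel \<Otimes>\<^sub>M lborel)"
    unfolding e_def by measurable
  have e_eq: "AE x in lborel. complex_of_real (h x) * complex_of_real x powr (Complex c u - 1) = e u x" for u
    using AE0 h0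
  proof eventually_elim
    case (elim x)
    show ?case
    proof (cases "x > 0")
      case True
      then show ?thesis by (simp add: e_def powr_def Ln_of_real)
    next
      case False
      then show ?thesis using elim by (simp add: e_def)
    qed
  qed
  have e0_int: "integrable lborel (e 0)"
  proof -
    have "AE x in lborel. complex_of_real (h x) * complex_of_real x powr (complex_of_real c - 1) = e 0 x"
      using e_eq[of 0] by (simp add: complex_of_real_def)
    then show ?thesis
      using h_int by (subst integrable_cong_AE[symmetric]) (auto simp: e_def)
  qed
  have e_norm: "norm (e u x) = indicator {0<..} x * (\<bar>h x\<bar> * exp ((c - 1) * ln x))" for u x
    by (simp add: e_def norm_mult)
  have k_int: "integrable (lborel \<Otimes>\<^sub>M lborel) (\<lambda>(u, x). e u x * w u)"
  proof (rule Bochner_Integration.integrable_bound[OF integrable_product_lborel[OF w_int e0_int]])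
    show "(\<lambda>(u, x). e u x * w u) \<in> borel_measurable (lborel \<Otimes>\<^sub>M lborel)" by measurable
  qed (auto simp: norm_mult e_norm)
  have K_eq: "(LINT x|lborel. complex_of_real (h x) * complex_of_real x powr (Complex c u - 1)) = (LINT x|lborel. e u x)" for u
  proof (rule integral_cong_AE[OF _ _ e_eq])
    show "(\<lambda>x. complex_of_real (h x) * complex_of_real x powr (Complex c u - 1)) \<in> borel_measurable lborel"
      by measurable
    show "(\<lambda>x. e u x) \<in> borel_measurable lborel"
      unfolding e_def by measurable
  qed
  show "integrable lborel (\<lambda>u. (LINT x|lborel. complex_of_real (h x) * complex_of_real x powr (Complex c u - 1)) * mellin_weight \<alpha> m (Complex c u))"
    using lborel_pair.integrable_fst'[OF k_int] by (simp add: K_eq w_def)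
  have inner_u: "(LINT u|lborel. e u x * w u) = complex_of_real (2 * pi * (indicator {0<..} x * (g x * h x)))" for x
  proof (cases "x > 0")
    case True
    have "(LINT u|lborel. e u x * w u) = (LINT u|lborel. complex_of_real (h x) * (mellin_weight \<alpha> m (Complex c u) * exp ((Complex c u - 1) * complex_of_real (ln x))))"
      using True by (intro Bochner_Integration.integral_cong) (auto simp: e_def w_def mult_ac)
    also have "\<dots> = complex_of_real (h x) * bromwich \<alpha> m x"
      by (simp add: bromwich_mellin_inversion[OF al m c True])
    finally show ?thesis using True by (simp add: gb)
  qed (simp add: e_def)
  have gh_AE: "AE x in lborel. indicator {0<..} x * (g x * h x) = g x * h x"
    using AE0 h0 by eventually_elim (auto split: split_indicator)
  \<comment> \<open>Integrability of \<open>h\<close> under \<open>M\<close> is a by-product of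
    Fubini's theorem, because the integral over u is a multiple of \<open>g x * h x\<close>.\<close>
  have "integrable lborel (\<lambda>x. complex_of_real (2 * pi * (indicator {0<..} x * (g x * h x))))"
    using lborel_pair.integrable_snd[OF k_int] by (simp add: inner_u)
  from integrable_Re[OF this] have ind_int: "integrable lborel (\<lambda>x. indicator {0<..} x * (g x * h x))"
    by simp
  then have gh_int: "integrable lborel (\<lambda>x. g x * h x)"
    using gh_AE by (subst (asm) integrable_cong_AE) auto
  then show "integrable M h"
    unfolding g(3) using g(1) by (subst integrable_density) auto
  have "(LINT u|lborel. (LINT x|lborel. complex_of_real (h x) * complex_of_real x powr (Complex c u - 1)) * mellin_weight \<alpha> m (Complex c u))
     = (LINT u|lborel. LINT x|lborel. e u x * w u)"
    by (simp add: K_eq w_def)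
  also have "\<dots> = (LINT x|lborel. LINT u|lborel. e u x * w u)"
    by (rule lborel_pair.Fubini_integral[symmetric]) (use k_int in simp)
  also have "\<dots> = complex_of_real (2 * pi * (LINT x|lborel. indicator {0<..} x * (g x * h x)))"
    unfolding inner_u by (subst integral_complex_of_real) simp
  also have "(LINT x|lborel. indicator {0<..} x * (g x * h x)) = (LINT x|lborel. g x * h x)"
    by (rule integral_cong_AE[OF _ _ gh_AE]) auto
  also have "\<dots> = (LINT x|M. h x)"
    unfolding g(3) using g(1) by (subst integral_density) auto
  finally show "(LINT u|lborel. (LINT x|lborel. complex_of_real (h x) * complex_of_real x powr (Complex c u - 1)) * mellin_weight \<alpha> m (Complex c u))
      = complex_of_real (2 * pi * (LINT x|M. h x))" .
qed

text \<open>For A in \<open>F\<close> the indicator of A generates a sub-sigma-algebra of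
  \<open>F\<close>, hence is independent of \<open>D\<close>, and the expectation of its product
  with \<open>h (D \<omega>)\<close> factors. So the constant satisfies the defining property of the
  conditional expectation.\<close>

lemma real_cond_exp_indep_eq_expectation:
  fixes D :: "'a \<Rightarrow> real" and h :: "real \<Rightarrow> real"
  assumes Q: "prob_space Q" and sub: "subalgebra Q F" and D: "D \<in> borel_measurable Q"
    and ind: "prob_space.indep_set Q (sets F) (sets (vimage_algebra (space Q) D borel))"
    and h: "h \<in> borel_measurable borel" and int: "integrable Q (\<lambda>\<omega>. h (D \<omega>))"
  shows "AE \<omega> in Q. real_cond_exp Q F (\<lambda>\<omega>. h (D \<omega>)) \<omega> = (LINT \<omega>|Q. h (D \<omega>))"
proof -
  interpret prob_space Q by fact
  interpret finite_measure_subalgebra Q F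
    by unfold_locales (rule sub)
  note D[measurable] h[measurable]
  have spF: "space F = space Q" and sF: "sets F \<subseteq> sets Q" using sub by (auto simp: subalgebra_def)
  show ?thesis
  proof (rule real_cond_exp_charact)
    fix A assume A: "A \<in> sets F"
    have AQ[measurable]: "A \<in> sets Q" using A sF by auto
    have "sigma_sets (space Q) {indicator A -` B \<inter> space Q |B. B \<in> sets borel} \<subseteq> sets F"
      unfolding sets_vimage_algebra[symmetric] using spF A by (intro sets_image_in_sets) auto
    then have "indep_var borel (indicator A :: 'a \<Rightarrow> real) borel D"
      using ind unfolding indep_var_eq indep_sets2_eq sets_vimage_algebra by (auto dest: subsetD)
    then have "indep_var borel ((\<lambda>x. x) \<circ> (indicator A :: 'a \<Rightarrow> real)) borel (h \<circ> D)"
      by (rule indep_var_compose) auto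
    moreover have "integrable Q (indicator A :: 'a \<Rightarrow> real)"
      by (rule integrable_real_indicator[OF AQ]) (simp add: emeasure_eq_measure)
    ultimately have "(LINT \<omega>|Q. indicator A \<omega> * h (D \<omega>)) = (LINT \<omega>|Q. indicator A \<omega>) * (LINT \<omega>|Q. h (D \<omega>))"
      by (intro indep_var_lebesgue_integral) (use int in \<open>auto simp: o_def\<close>)
    then show "(LINT \<omega>:A|Q. h (D \<omega>)) = (LINT \<omega>:A|Q. (LINT \<omega>|Q. h (D \<omega>)))"
      by (simp add: set_lebesgue_integral_def)
  qed (use int in auto)
qed

text \<open>The two integrability claims keep the identity from resting on default values of
  divergent integrals. The premise \<open>power_defined\<close> confines the payoff to x >= 0 up to
  a null set, where the power needs no choice of branch and the Mellin transform determines the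
  law.\<close>

theorem proposition1:
  fixes Q :: "'a measure" and F :: "real \<Rightarrow> 'a measure" and X :: "real \<Rightarrow> 'a \<Rightarrow> real"
    and P :: "real \<Rightarrow> real ^ 'n \<Rightarrow> real" and K :: "real ^ 'n"
    and \<sigma> \<alpha> \<mu> S r t T \<tau> c\<^sub>m c\<^sub>p c\<^sub>1 :: real
  assumes "\<sigma> > 0" and "1 < \<alpha>" and "\<alpha> \<le> 2"
    and "fmls_process \<sigma> \<alpha> Q F X"
    and "\<mu> = \<sigma> powr \<alpha> / cos (pi * \<alpha> / 2)"
    and "S > 0" and "\<And>i. K $ i > 0"
    and "0 \<le> t" and "t < T" and "\<tau> = T - t"
    and "c\<^sub>m < c\<^sub>p"
    and convergent: "\<And>s. Re s \<in> {c\<^sub>m<..<c\<^sub>p} \<Longrightarrow>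
           integrable lborel (K_star_integrand P S K r \<mu> \<tau> s)"
    and power_defined: "AE x in lborel. x < 0 \<longrightarrow> P (S * exp ((r + \<mu>) * \<tau> + x)) K = 0"
    and "{c\<^sub>m<..<c\<^sub>p} \<inter> {..<-1} \<noteq> {}"
    and "c\<^sub>1 \<in> {c\<^sub>m<..<c\<^sub>p} \<inter> {..<-1}"
  shows "integrable Q (discounted_payoff P S K r \<mu> X t T) \<and>
    vertical_integrable
      (\<lambda>s. K_star P S K r \<mu> \<tau> s * G_star \<alpha> s
           * complex_of_real (- \<mu> * \<tau>) powr (- s / complex_of_real \<alpha>) / (2 * \<i> * complex_of_real pi))
      c\<^sub>1 \<and>
    (AE \<omega> in Q. complex_of_real (option_value Q F P S K r \<mu> X t T \<omega>) =
       complex_of_real (exp (- r * \<tau>)) *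
       vertical_integral
         (\<lambda>s. K_star P S K r \<mu> \<tau> s * G_star \<alpha> s
              * complex_of_real (- \<mu> * \<tau>) powr (- s / complex_of_real \<alpha>) / (2 * \<i> * complex_of_real pi))
         c\<^sub>1)"
proof -
  note al = assms(2,3)
  define m where "m = - \<mu> * \<tau>"
  have m: "m > 0"
  proof -
    have "\<mu> < 0"
      unfolding assms(5) using assms(1) cos_half_pi_neg[OF al] by (intro divide_pos_neg) (auto simp: mult.commute)
    then show ?thesis using assms(9,10) by (simp add: m_def mult_neg_pos)
  qed
  have levy: "levy_process Q F X"
    and ch: "\<And>t k. t \<ge> 0 \<Longrightarrow> char (distr Q borel (X t)) k = exp (- complex_of_real (t * \<sigma> powr \<alpha> * \<bar>k\<bar> powr \<alpha>)
             * (1 + \<i> * complex_of_real (tan (\<alpha> * pi / 2) * sgn k)))"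
    using assms(4) by (auto simp: fmls_process_def)
  have Q: "prob_space Q" using levy by (simp add: levy_process_def)
  interpret prob_space Q by fact
  have "\<forall>t\<ge>0. subalgebra Q (F t)" and "\<forall>t\<ge>0. X t \<in> borel_measurable (F t)"
    using levy unfolding levy_process_def by blast+
  then have sub: "subalgebra Q (F t)" and Xm: "X t \<in> borel_measurable Q" "X T \<in> borel_measurable Q"
    using assms(8,9) measurable_from_subalg[of Q "F t" "X t" borel] measurable_from_subalg[of Q "F T" "X T" borel]
    by (meson less_eq_real_def order_trans)+
  define D where "D = (\<lambda>\<omega>. X T \<omega> - X t \<omega>)"
  have D[measurable]: "D \<in> borel_measurable Q"
    unfolding D_def using Xm by (rule borel_measurable_diff[rotated])
  have "\<forall>s t. 0 \<le> s \<and> s \<le> t \<longrightarrow> indep_set (sets (F s)) (sets (vimage_algebra (space Q) (\<lambda>\<omega>. X t \<omega> - X s \<omega>) borel))"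
    and incr: "\<forall>s t. 0 \<le> s \<and> s \<le> t \<longrightarrow> distr Q borel (\<lambda>\<omega>. X t \<omega> - X s \<omega>) = distr Q borel (X (t - s))"
    using levy unfolding levy_process_def by blast+
  then have ind: "indep_set (sets (F t)) (sets (vimage_algebra (space Q) D borel))"
    using assms(8,9) unfolding D_def by simp
  define M where "M = distr Q borel D"
  \<comment> \<open>Stationarity of the increments makes the given characteristic function of
    \<open>X \<tau>\<close> available for the increment, while independence of \<open>F t\<close>
    holds for the increment itself.\<close>
  have M_eq: "M = distr Q borel (X \<tau>)"
    using incr assms(8-10) unfolding M_def D_def by simp
  have M: "real_distribution M" unfolding M_def by (rule real_distribution_distr[OF D])
  have chM: "\<forall>k. k \<noteq> 0 \<longrightarrow> char M k = exp (complex_of_real m * Complex 0 k powr complex_of_real \<alpha>)"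
  proof (intro allI impI)
    fix k :: real assume k: "k \<noteq> 0"
    show "char M k = exp (complex_of_real m * Complex 0 k powr complex_of_real \<alpha>)"
      unfolding M_eq m_def stable_char_exponent[OF al assms(5) k, symmetric]
      by (rule ch) (use assms(9,10) in simp)
  qed
  define h where "h = (\<lambda>x. P (S * exp ((r + \<mu>) * \<tau> + x)) K)"
  have c: "c\<^sub>1 \<in> {c\<^sub>m<..<c\<^sub>p}" "c\<^sub>1 < 1" using assms(15) by auto
  have K_int: "integrable lborel (\<lambda>x. complex_of_real (h x) * complex_of_real x powr (complex_of_real c\<^sub>1 - 1))"
    using convergent[of "complex_of_real c\<^sub>1"] c(1) by (simp add: K_star_integrand_def[abs_def] h_def)
  have h[measurable]: "h \<in> borel_measurable borel"
  proof -
    have [measurable]: "(\<lambda>x. complex_of_real (h x) * complex_of_real x powr (complex_of_real c\<^sub>1 - 1)) \<in> borel_measurable borel"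
      using K_int by auto
    \<comment> \<open>Measurability of the payoff is recovered from the integrand of
      \<open>K_star\<close> by dividing by a power that vanishes only at x = 0, where
      \<open>powr\<close> takes the value 0.\<close>
    have "h = (\<lambda>x. if x = 0 then h 0 else Re ((complex_of_real (h x) * complex_of_real x powr (complex_of_real c\<^sub>1 - 1)) / complex_of_real x powr (complex_of_real c\<^sub>1 - 1)))"
      by (auto simp: fun_eq_iff)
    also have "\<dots> \<in> borel_measurable borel" by measurable
    finally show ?thesis .
  qed
  have h0: "AE x in lborel. x < 0 \<longrightarrow> h x = 0"
    using power_defined by (simp add: h_def)
  note parseval = mellin_parseval[OF M al m chM c(2) h h0 K_int]
  have K_eq: "K_star P S K r \<mu> \<tau> s = (LINT x|lborel. complex_of_real (h x) * complex_of_real x powr (s - 1))" for s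
    by (simp add: K_star_def K_star_integrand_def h_def)
  have weight: "G_star \<alpha> s * complex_of_real (- \<mu> * \<tau>) powr (- s / complex_of_real \<alpha>) = mellin_weight \<alpha> m s" for s
    using m unfolding m_def[symmetric] by (simp add: mellin_weight_def powr_def Ln_of_real)
  \<comment> \<open>The \<i> from ds = \<i> du cancels against 2 pi \<i>; the remaining 1 / (2 pi)
    matches the factor 2 pi in the Parseval formula.\<close>
  have integrand: "K_star P S K r \<mu> \<tau> s * G_star \<alpha> s * complex_of_real (- \<mu> * \<tau>) powr (- s / complex_of_real \<alpha>) / (2 * \<i> * complex_of_real pi) * \<i>
     = (LINT x|lborel. complex_of_real (h x) * complex_of_real x powr (s - 1)) * mellin_weight \<alpha> m s / (2 * complex_of_real pi)" for s
    unfolding weight[symmetric] K_eq[symmetric] by (simp add: field_simps)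
  have hD: "integrable Q (\<lambda>\<omega>. h (D \<omega>))" "(LINT x|M. h x) = (LINT \<omega>|Q. h (D \<omega>))"
    using parseval(1) unfolding M_def by (simp_all add: integrable_distr_eq integral_distr)
  have payoff: "discounted_payoff P S K r \<mu> X t T = (\<lambda>\<omega>. exp (- r * \<tau>) * h (D \<omega>))"
    by (simp add: discounted_payoff_def[abs_def] terminal_price_def h_def D_def assms(10))
  have int: "integrable Q (discounted_payoff P S K r \<mu> X t T)"
    unfolding payoff using hD(1) by simp
  have vint: "vertical_integrable
      (\<lambda>s. K_star P S K r \<mu> \<tau> s * G_star \<alpha> s
           * complex_of_real (- \<mu> * \<tau>) powr (- s / complex_of_real \<alpha>) / (2 * \<i> * complex_of_real pi)) c\<^sub>1"
    unfolding vertical_integrable_def integrand using parseval(2) by simp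
  have val: "vertical_integral
      (\<lambda>s. K_star P S K r \<mu> \<tau> s * G_star \<alpha> s
           * complex_of_real (- \<mu> * \<tau>) powr (- s / complex_of_real \<alpha>) / (2 * \<i> * complex_of_real pi)) c\<^sub>1
      = complex_of_real (LINT \<omega>|Q. h (D \<omega>))"
    unfolding vertical_integral_def integrand using parseval(3) hD(2) by simp
  have "AE \<omega> in Q. real_cond_exp Q (F t) (\<lambda>\<omega>. exp (- r * \<tau>) * h (D \<omega>)) \<omega> = (LINT \<omega>|Q. exp (- r * \<tau>) * h (D \<omega>))"
    by (rule real_cond_exp_indep_eq_expectation[OF Q sub D ind]) (use hD(1) in auto)
  then have "AE \<omega> in Q. complex_of_real (option_value Q F P S K r \<mu> X t T \<omega>) =
       complex_of_real (exp (- r * \<tau>)) * complex_of_real (LINT \<omega>|Q. h (D \<omega>))"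
    unfolding option_value_def payoff by eventually_elim simp
  then show ?thesis using int vint unfolding val by blast
qed

end
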